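(* Let $m,n>-1/2$ and $0\le|\beta_i|<\alpha_i$, $i=1,2$. Let $X\sim\mathrm{VG}(m,\alpha_1,\beta_1,0)$ and $Y\sim\mathrm{VG}(n,\alpha_2,\beta_2,0)$ be independent, and let $f_Z$ be the probability density function of $Z=X/Y$. 1. Suppose $m>0$. Then $$f_Z(0)=\frac{\gamma_1^{2m+1}\gamma_2^{2n+1}}{\pi\alpha_1^{2m}\alpha_2^{2n+2}}\,\frac{\Gamma(m)\Gamma(n+1)}{\Gamma(m+1/2)\Gamma(n+1/2)}\,{}_2F_1\bigg(1,n+1;\frac12;\frac{\beta_2^2}{\alpha_2^2}\bigg).$$ 2. Suppose $m=0$. Then, as $z\to0$, $$f_Z(z)\sim-\frac{2\gamma_1\gamma_2^{2n+1}}{\pi^{3/2}\alpha_2^{2n+2}}\,\frac{\Gamma(n+1)\log|z|}{\Gamma(n+1/2)}\,{}_2F_1\bigg(1,n+1;\frac12;\frac{\beta_2^2}{\alpha_2^2}\bigg).$$ 3. Suppose $-1/2<m<0$. Then, as $z\to0$, $$f_Z(z)\sim\frac{\gamma_1^{2m+1}\gamma_2^{2n+1}}{\alpha_2^{2m+2n+2}\sin(-m\pi)}\,\frac{\Gamma(m+n+1)|z|^{2m}}{\Gamma(m+1/2)\Gamma(n+1/2)}\,{}_2F_1\bigg(m+1,m+n+1;\frac12;\frac{\beta_2^2}{\alpha_2^2}\bigg).$$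
   Context: For $m>-1/2$ and $0\le|\beta|<\alpha$, a random variable $X$ has the variance-gamma distribution $\mathrm{VG}(m,\alpha,\beta,0)$ if it has probability density function $$f_X(x)=\frac{\gamma^{2m+1}}{\sqrt{\pi}(2\alpha)^m\Gamma(m+1/2)}\,\mathrm{e}^{\beta x}|x|^mK_m(\alpha|x|),\quad x\in\mathbb{R},\qquad \gamma^2=\alpha^2-\beta^2,\ \gamma>0,$$ where $K_m(x)=\int_0^\infty \mathrm{e}^{-x\cosh t}\cosh(mt)\,\mathrm{d}t$, $x>0$, is the modified Bessel function of the second kind; for $m>0$ the value at $x=0$ is the limiting value. Notation: $\gamma_i=\sqrt{\alpha_i^2-\beta_i^2}$, $i=1,2$. ${}_2F_1(a,b;c;x)=\sum_{k=0}^\infty\frac{(a)_k(b)_k}{(c)_k}\frac{x^k}{k!}$ for $|x|<1$, with $(u)_k=u(u+1)\cdots(u+k-1)$. The density of the ratio is the version $f_Z(z)=\int_{-\infty}^\infty|y|f_X(yz)f_Y(y)\,\mathrm{d}y$. The relation $f(z)\sim g(z)$ means $f(z)/g(z)\to1$ in the stated limit. *)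

theory Defs
  imports "HOL-Probability.Probability" "HOL-Library.Landau_Symbols"
begin

definition bessel_K :: "real \<Rightarrow> real \<Rightarrow> real" where
  "bessel_K m x = (LBINT t:{0<..}. exp (- x * cosh t) * cosh (m * t))"

definition hyp2F1 :: "real \<Rightarrow> real \<Rightarrow> real \<Rightarrow> real \<Rightarrow> real" where
  "hyp2F1 a b c x =
     (\<Sum>k. pochhammer a k * pochhammer b k / pochhammer c k * (x ^ k / fact k))"

definition vg_gamma :: "real \<Rightarrow> real \<Rightarrow> real" where
  "vg_gamma \<alpha> \<beta> = sqrt (\<alpha>\<^sup>2 - \<beta>\<^sup>2)"

definition vg_formula :: "real \<Rightarrow> real \<Rightarrow> real \<Rightarrow> real \<Rightarrow> real" where
  "vg_formula m \<alpha> \<beta> x =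
     vg_gamma \<alpha> \<beta> powr (2 * m + 1) / (sqrt pi * (2 * \<alpha>) powr m * Gamma (m + 1/2))
       * exp (\<beta> * x) * \<bar>x\<bar> powr m * bessel_K m (\<alpha> * \<bar>x\<bar>)"

text \<open>Density of the variance-gamma law with location parameter 0. At \<open>x = 0\<close> the closed formula
  is indeterminate. For \<open>m > 0\<close> it has a finite limit, which is taken as the value there; for
  \<open>m \<le> 0\<close> it tends to infinity, and the value 0 at this single point is an arbitrary choice.\<close>

definition vg_density :: "real \<Rightarrow> real \<Rightarrow> real \<Rightarrow> real \<Rightarrow> real" where
  "vg_density m \<alpha> \<beta> x =
     (if x \<noteq> 0 then vg_formula m \<alpha> \<beta> x
      else if m > 0 then Lim (at 0) (vg_formula m \<alpha> \<beta>)
      else 0)"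

definition vg_distributed ::
    "'a measure \<Rightarrow> ('a \<Rightarrow> real) \<Rightarrow> real \<Rightarrow> real \<Rightarrow> real \<Rightarrow> bool" where
  "vg_distributed M X m \<alpha> \<beta> \<longleftrightarrow> distributed M lborel X (\<lambda>x. ennreal (vg_density m \<alpha> \<beta> x))"

definition ratio_density :: "(real \<Rightarrow> real) \<Rightarrow> (real \<Rightarrow> real) \<Rightarrow> real \<Rightarrow> real" where
  "ratio_density f g z = (LBINT y. \<bar>y\<bar> * f (y * z) * g y)"

end

theory Submission imports Defs begin

text \<open>
  As \<open>z\<close> tends to \<open>0\<close>, the factor \<open>f_X (y * z)\<close> in the integral defining \<open>f_Z z\<close> behaves like
  its leading term at the origin: a constant, a multiple of \<open>- ln \<bar>z\<bar>\<close> or a multiple of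
  \<open>\<bar>y * z\<bar> powr (2 * m)\<close>, according to the sign of \<open>m\<close>. By dominated convergence the coefficient
  of \<open>f_Z\<close> is the one of \<open>f_X\<close> times an absolute moment of \<open>Y\<close>. That moment is computed by expanding
  \<open>exp (\<beta> * y)\<close> in powers of \<open>y\<close> and using the Mellin transform of the Bessel function; the resulting
  series is the hypergeometric one.

  All Bessel integrals are treated in logarithmic coordinates, starting from
  \<open>2 K\<^sub>\<mu> x = \<integral> exp (\<mu> t - x cosh t) dt\<close> over the whole line.
\<close>

section \<open>Integrals in logarithmic coordinates\<close>

text \<open>The obstacle is the domination. The factor \<open>exp (\<beta>1 * (y * z))\<close> of
  the first density is unbounded in \<open>y\<close>, so a majorant free of \<open>z\<close> must
  spend part of the exponential decay of the second density. That decay beats the growth of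
  \<open>exp (\<beta>2 * y)\<close> by the rate \<open>\<alpha>2 - \<bar>\<beta>2\<bar>\<close>;
  half of this gap, \<open>\<epsilon>\<close>, bounds \<open>\<bar>\<beta>1 * z\<bar>\<close> for
  small \<open>z\<close>. The majorant stays integrable because a factor \<open>exp (b * y)\<close>
  merely replaces \<open>\<beta>2\<close> by \<open>\<beta>2 + b\<close> in the moment formula. One
  computation thus serves the constants and the majorants. Its parameter \<open>a\<close> stands for
  the power \<open>2 * a - 1\<close> of \<open>\<bar>y\<bar>\<close>: the constants need
  \<open>a = 1\<close> for \<open>m \<ge> 0\<close> and \<open>a = m + 1\<close> for
  \<open>m < 0\<close>.

  For \<open>m > 0\<close> no limit is taken, since \<open>y * 0 = 0\<close>. For
  \<open>m < 0\<close> evenness of the Bessel function in its order supplies the singularity, and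
  the sine comes from the reflection formula for \<open>Gamma (- m) * Gamma (m + 1)\<close>.

  The Bessel and moment integrals are evaluated as nonnegative ones, so that finiteness comes with
  the value and integrals and sums may be exchanged freely.\<close>

lemma nn_integral_SUP_truncate:
  fixes h :: "real \<Rightarrow> ennreal" and A :: "nat \<Rightarrow> real set"
  assumes [measurable]: "h \<in> borel_measurable lborel" "\<And>N. A N \<in> sets borel" and "incseq A"
  shows "(\<integral>\<^sup>+t. h t * indicator (\<Union>N. A N) t \<partial>lborel) = (SUP N. \<integral>\<^sup>+t. h t * indicator (A N) t \<partial>lborel)"
  using SUP_emeasure_incseq[of A "density lborel h"] assms
  by (auto simp: emeasure_density image_subset_iff)

text \<open>The substitution rule is available on compact intervals; both sides are exhausted by
  matching intervals and the limit is taken by monotone convergence.\<close>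

lemma nn_integral_exp_substitution:
  fixes f :: "real \<Rightarrow> real"
  assumes [measurable]: "f \<in> borel_measurable borel"
  shows "(\<integral>\<^sup>+v. ennreal (f v) * indicator {0<..} v \<partial>lborel) = (\<integral>\<^sup>+t. ennreal (f (exp t) * exp t) \<partial>lborel)"
proof -
  \<comment> \<open>\<open>A N\<close> is the image of \<open>B N\<close> under \<open>exp\<close>,
    so the truncated integrals agree for each \<open>N\<close>.\<close>
  define A B where "A N = {exp (- real N)..exp (real N)}" and "B N = {- real N..real N}" for N
  have UA: "(\<Union>N. A N) = {0<..}"
  proof safe
    fix x :: real assume "x > 0"
    obtain N where "\<bar>ln x\<bar> \<le> real N" using real_arch_simple by blast
    then have "exp (- real N) \<le> exp (ln x)" "exp (ln x) \<le> exp (real N)" by auto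
    then show "x \<in> \<Union> (range A)" using \<open>x > 0\<close> unfolding A_def by (auto intro!: exI[of _ N])
  qed (auto simp: A_def intro: less_le_trans[OF exp_gt_zero])
  have UB: "(\<Union>N. B N) = UNIV"
  proof safe
    fix x :: real
    obtain N where "\<bar>x\<bar> \<le> real N" using real_arch_simple by blast
    then show "x \<in> \<Union> (range B)" unfolding B_def by (auto intro!: exI[of _ N])
  qed auto
  have iA: "incseq A" and iB: "incseq B"
    by (auto simp: incseq_def A_def B_def intro: order_trans)
  have "(\<integral>\<^sup>+v. ennreal (f v) * indicator {0<..} v \<partial>lborel) = (SUP N. \<integral>\<^sup>+t. ennreal (f t) * indicator (A N) t \<partial>lborel)"
    by (subst nn_integral_SUP_truncate [symmetric, OF _ _ iA]) (auto simp: UA, auto simp: A_def)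
  also have "\<dots> = (SUP N. \<integral>\<^sup>+t. ennreal (f (exp t) * exp t) * indicator (B N) t \<partial>lborel)"
  proof (intro SUP_cong refl)
    fix N
    have "(\<integral>\<^sup>+t. ennreal (f t * indicator (A N) t) \<partial>lborel) =
        (\<integral>\<^sup>+t. ennreal (f (exp t) * exp t * indicator (B N) t) \<partial>lborel)"
      unfolding A_def B_def
      by (rule nn_integral_substitution)
        (auto intro!: derivative_eq_intros continuous_intros simp: set_borel_measurable_def)
    then show "(\<integral>\<^sup>+t. ennreal (f t) * indicator (A N) t \<partial>lborel) =
        (\<integral>\<^sup>+t. ennreal (f (exp t) * exp t) * indicator (B N) t \<partial>lborel)"
      by (simp add: nn_integral_set_ennreal)
  qed
  also have "\<dots> = (\<integral>\<^sup>+t. ennreal (f (exp t) * exp t) \<partial>lborel)"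
    by (subst nn_integral_SUP_truncate [symmetric, OF _ _ iB]) (auto simp: UB, auto simp: B_def)
  finally show ?thesis .
qed

lemma nn_integral_Gamma_exp:
  fixes a c :: real
  assumes "a > 0" "c > 0"
  shows "(\<integral>\<^sup>+t. ennreal (exp (a * t - c * exp t)) \<partial>lborel) = ennreal (Gamma a * c powr (- a))"
proof -
  have "ennreal (Gamma a) = (\<integral>\<^sup>+t. ennreal (t powr (a - 1) / exp t) * indicator {0<..} t \<partial>lborel)"
    using nn_integral_has_integral_lebesgue'[OF _ Gamma_integral_real[OF \<open>a > 0\<close>]]
    by (auto simp: indicator_def intro!: nn_integral_cong elim!: trans[OF sym])
  also have "\<dots> = (\<integral>\<^sup>+t. ennreal (exp t powr (a - 1) / exp (exp t) * exp t) \<partial>lborel)"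
    by (rule nn_integral_exp_substitution) simp
  also have "\<dots> = (\<integral>\<^sup>+t. ennreal (exp (a * t - exp t)) \<partial>lborel)"
    by (intro nn_integral_cong arg_cong[of _ _ ennreal])
      (simp add: powr_def exp_diff [symmetric] exp_add [symmetric] left_diff_distrib)
  \<comment> \<open>In logarithmic coordinates the scaling by \<open>c\<close> is a translation by
    \<open>ln c\<close>.\<close>
  also have "\<dots> = (\<integral>\<^sup>+t. ennreal (exp (a * (ln c + t) - exp (ln c + t))) \<partial>lborel)"
    by (subst nn_integral_real_affine[where c=1 and t="ln c"]) auto
  also have "\<dots> = (\<integral>\<^sup>+t. ennreal (c powr a) * ennreal (exp (a * t - c * exp t)) \<partial>lborel)"
  proof (intro nn_integral_cong)
    fix t
    have "exp (ln c + t) = c * exp t" using \<open>c > 0\<close> by (simp add: exp_add)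
    then have "exp (a * (ln c + t) - exp (ln c + t)) = c powr a * exp (a * t - c * exp t)"
      using \<open>c > 0\<close> by (simp add: powr_def exp_add [symmetric] algebra_simps)
    then show "ennreal (exp (a * (ln c + t) - exp (ln c + t))) = ennreal (c powr a) * ennreal (exp (a * t - c * exp t))"
      by (simp add: ennreal_mult')
  qed
  also have "\<dots> = ennreal (c powr a) * (\<integral>\<^sup>+t. ennreal (exp (a * t - c * exp t)) \<partial>lborel)"
    by (subst nn_integral_cmult) auto
  finally have "ennreal (c powr (- a)) * ennreal (Gamma a) =
      ennreal (c powr (- a) * c powr a) * (\<integral>\<^sup>+t. ennreal (exp (a * t - c * exp t)) \<partial>lborel)"
    by (simp add: ennreal_mult' mult.assoc)
  then show ?thesis
    using assms by (simp add: powr_add [symmetric] ennreal_mult' [symmetric] mult.commute)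
qed

section \<open>The modified Bessel function\<close>

definition bessel_kernel :: "real \<Rightarrow> real \<Rightarrow> real \<Rightarrow> real" where
  "bessel_kernel \<mu> x t = exp (\<mu> * t - x * cosh t)"

lemma bessel_kernel_measurable [measurable]:
  "(\<lambda>p. bessel_kernel \<mu> (fst p) (snd p)) \<in> borel_measurable (borel \<Otimes>\<^sub>M borel)"
  "bessel_kernel \<mu> x \<in> borel_measurable borel"
  unfolding bessel_kernel_def cosh_def by measurable

text \<open>Folding the line at 0 turns \<open>exp (\<mu> * t)\<close> into
  \<open>2 * cosh (\<mu> * t)\<close>. The exponential weight is preferred because a translation of
  \<open>t\<close> only multiplies it by a constant.\<close>

lemma nn_integral_bessel_kernel:
  "(\<integral>\<^sup>+t. ennreal (bessel_kernel \<mu> x t) \<partial>lborel) =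
    2 * (\<integral>\<^sup>+t. ennreal (exp (- x * cosh t) * cosh (\<mu> * t)) * indicator {0<..} t \<partial>lborel)"
proof -
  have m: "(\<lambda>t. exp (- x * cosh t) * cosh (\<mu> * t)) \<in> borel_measurable borel"
    unfolding cosh_def by measurable
  have "(\<integral>\<^sup>+t. ennreal (bessel_kernel \<mu> x t) \<partial>lborel) =
     (\<integral>\<^sup>+t. ennreal (bessel_kernel \<mu> x t) * indicator {0<..} t
         + ennreal (bessel_kernel \<mu> x t) * indicator {..<0} t \<partial>lborel)"
    by (intro nn_integral_cong_AE, use AE_lborel_singleton[of "0::real"] in eventually_elim)
      (auto simp: indicator_def)
  also have "\<dots> = (\<integral>\<^sup>+t. ennreal (bessel_kernel \<mu> x t) * indicator {0<..} t \<partial>lborel)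
         + (\<integral>\<^sup>+t. ennreal (bessel_kernel \<mu> x t) * indicator {..<0} t \<partial>lborel)"
    by (rule nn_integral_add) auto
  also have "(\<integral>\<^sup>+t. ennreal (bessel_kernel \<mu> x t) * indicator {..<0} t \<partial>lborel) =
     (\<integral>\<^sup>+t. ennreal (bessel_kernel \<mu> x (- t)) * indicator {0<..} t \<partial>lborel)"
    by (subst nn_integral_real_affine[where c="-1" and t=0]) (auto simp: indicator_def intro!: nn_integral_cong)
  also have "(\<integral>\<^sup>+t. ennreal (bessel_kernel \<mu> x t) * indicator {0<..} t \<partial>lborel) + \<dots> =
     (\<integral>\<^sup>+t. ennreal (bessel_kernel \<mu> x t) * indicator {0<..} t
         + ennreal (bessel_kernel \<mu> x (- t)) * indicator {0<..} t \<partial>lborel)"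
    by (rule nn_integral_add [symmetric]) auto
  also have "\<dots> = (\<integral>\<^sup>+t. 2 * (ennreal (exp (- x * cosh t) * cosh (\<mu> * t)) * indicator {0<..} t) \<partial>lborel)"
  proof (intro nn_integral_cong)
    fix t :: real
    have "bessel_kernel \<mu> x t + bessel_kernel \<mu> x (- t) = 2 * (exp (- x * cosh t) * cosh (\<mu> * t))"
      by (simp add: bessel_kernel_def cosh_def[of "\<mu> * t"] exp_diff exp_minus field_simps)
    then have "ennreal (bessel_kernel \<mu> x t) + ennreal (bessel_kernel \<mu> x (- t)) =
        2 * ennreal (exp (- x * cosh t) * cosh (\<mu> * t))"
      by (simp add: ennreal_plus [symmetric] bessel_kernel_def ennreal_mult' del: ennreal_plus)
    then show "ennreal (bessel_kernel \<mu> x t) * indicator {0<..} t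
         + ennreal (bessel_kernel \<mu> x (- t)) * indicator {0<..} t =
         2 * (ennreal (exp (- x * cosh t) * cosh (\<mu> * t)) * indicator {0<..} t)"
      by (simp add: indicator_def)
  qed
  also have "\<dots> = 2 * (\<integral>\<^sup>+t. ennreal (exp (- x * cosh t) * cosh (\<mu> * t)) * indicator {0<..} t \<partial>lborel)"
    using m by (intro nn_integral_cmult) auto
  finally show ?thesis .
qed

text \<open>No condition on \<open>x\<close> is imposed: if the integral diverges, the Bochner
  integral and \<open>enn2real\<close> of infinity are both 0.\<close>

lemma bessel_K_eq_enn2real:
  "bessel_K \<mu> x = enn2real (\<integral>\<^sup>+t. ennreal (bessel_kernel \<mu> x t) \<partial>lborel) / 2"
proof -
  have m [measurable]: "(\<lambda>t. exp (- x * cosh t) * cosh (\<mu> * t)) \<in> borel_measurable borel"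
    unfolding cosh_def by measurable
  have "(\<lambda>t. indicator {0<..} t *\<^sub>R (exp (- x * cosh t) * cosh (\<mu> * t))) \<in> borel_measurable lborel"
    using m by measurable
  then have "bessel_K \<mu> x = enn2real (\<integral>\<^sup>+t. ennreal (exp (- x * cosh t) * cosh (\<mu> * t)) * indicator {0<..} t \<partial>lborel)"
    unfolding bessel_K_def set_lebesgue_integral_def
    by (subst integral_eq_nn_integral, assumption)
      (auto simp: indicator_def intro!: arg_cong[of _ _ enn2real] nn_integral_cong)
  then show ?thesis
    by (simp add: nn_integral_bessel_kernel enn2real_mult)
qed

lemma bessel_K_nonneg [simp]: "bessel_K \<mu> x \<ge> 0"
  by (simp add: bessel_K_eq_enn2real)

lemma bessel_K_measurable [measurable]: "bessel_K \<mu> \<in> borel_measurable borel"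
proof -
  have "bessel_K \<mu> = (\<lambda>x. enn2real (\<integral>\<^sup>+t. ennreal (bessel_kernel \<mu> x t) \<partial>lborel) / 2)"
    by (simp add: fun_eq_iff bessel_K_eq_enn2real)
  also have "\<dots> \<in> borel_measurable borel"
    unfolding bessel_kernel_def cosh_def by measurable
  finally show ?thesis .
qed

lemma nn_integral_bessel_kernel_uminus:
  "(\<integral>\<^sup>+t. ennreal (bessel_kernel (- \<mu>) x t) \<partial>lborel) = (\<integral>\<^sup>+t. ennreal (bessel_kernel \<mu> x t) \<partial>lborel)"
  by (simp add: nn_integral_bessel_kernel)

text \<open>For \<open>m < 0\<close> this gives access to the singularity of the positive order
  \<open>- m\<close>.\<close>

lemma bessel_K_uminus: "bessel_K (- \<mu>) x = bessel_K \<mu> x"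
  by (simp add: bessel_K_def)

text \<open>Shifting \<open>t\<close> by \<open>ln x\<close> extracts the singularity \<open>x powr - \<mu>\<close> of \<open>K\<close> at the origin.\<close>

lemma nn_integral_bessel_kernel_shift:
  assumes "x > 0"
  shows "(\<integral>\<^sup>+t. ennreal (bessel_kernel \<mu> x t) \<partial>lborel) =
    ennreal (x powr - \<mu>) * (\<integral>\<^sup>+t. ennreal (exp (\<mu> * t - exp t / 2 - x\<^sup>2 * exp (- t) / 2)) \<partial>lborel)"
proof -
  have "(\<integral>\<^sup>+t. ennreal (bessel_kernel \<mu> x t) \<partial>lborel) = (\<integral>\<^sup>+t. ennreal (bessel_kernel \<mu> x (- ln x + t)) \<partial>lborel)"
    by (subst nn_integral_real_affine[where c=1 and t="- ln x"]) auto
  also have "\<dots> = (\<integral>\<^sup>+t. ennreal (x powr - \<mu>) * ennreal (exp (\<mu> * t - exp t / 2 - x\<^sup>2 * exp (- t) / 2)) \<partial>lborel)"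
  proof (intro nn_integral_cong)
    fix t
    have "exp (- ln x + t) = exp t / x" "exp (- (- ln x + t)) = x * exp (- t)"
      using assms by (simp_all add: exp_add exp_diff exp_minus field_simps)
    then have "x * cosh (- ln x + t) = exp t / 2 + x\<^sup>2 * exp (- t) / 2"
      using assms unfolding cosh_def by (simp add: field_simps power2_eq_square)
    then have "bessel_kernel \<mu> x (- ln x + t) = x powr - \<mu> * exp (\<mu> * t - exp t / 2 - x\<^sup>2 * exp (- t) / 2)"
      using assms by (simp add: bessel_kernel_def powr_def exp_add [symmetric] algebra_simps)
    then show "ennreal (bessel_kernel \<mu> x (- ln x + t)) =
        ennreal (x powr - \<mu>) * ennreal (exp (\<mu> * t - exp t / 2 - x\<^sup>2 * exp (- t) / 2))"
      by (simp add: ennreal_mult')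
  qed
  also have "\<dots> = ennreal (x powr - \<mu>) * (\<integral>\<^sup>+t. ennreal (exp (\<mu> * t - exp t / 2 - x\<^sup>2 * exp (- t) / 2)) \<partial>lborel)"
    by (rule nn_integral_cmult) measurable
  finally show ?thesis .
qed

text \<open>This kernel is both the pointwise limit, as \<open>x\<close> tends to 0, and an
  integrable majorant of the shifted Bessel kernel.\<close>

lemma Gamma_kernel_half:
  fixes \<mu> :: real
  assumes "\<mu> > 0"
  shows "integrable lborel (\<lambda>t. exp (\<mu> * t - exp t / 2))"
    and "(LBINT t. exp (\<mu> * t - exp t / 2)) = 2 powr \<mu> * Gamma \<mu>"
proof -
  have "has_bochner_integral lborel (\<lambda>t. exp (\<mu> * t - exp t / 2)) (2 powr \<mu> * Gamma \<mu>)"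
    using nn_integral_Gamma_exp[OF assms, of "1/2"] assms
    by (intro has_bochner_integral_nn_integral)
      (auto simp: powr_minus powr_divide mult.commute Gamma_real_pos less_imp_le)
  then show "integrable lborel (\<lambda>t. exp (\<mu> * t - exp t / 2))"
    and "(LBINT t. exp (\<mu> * t - exp t / 2)) = 2 powr \<mu> * Gamma \<mu>"
    by (auto simp: has_bochner_integral_iff)
qed

lemma integrable_shifted_kernel:
  fixes \<mu> x :: real
  assumes "\<mu> > 0"
  shows "integrable lborel (\<lambda>t. exp (\<mu> * t - exp t / 2 - x\<^sup>2 * exp (- t) / 2))"
  by (rule Bochner_Integration.integrable_bound[OF Gamma_kernel_half(1)[OF assms]]) auto

lemma powr_mult_bessel_K:
  assumes "\<mu> > 0" "x > 0"
  shows "x powr \<mu> * bessel_K \<mu> x = (LBINT t. exp (\<mu> * t - exp t / 2 - x\<^sup>2 * exp (- t) / 2)) / 2"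
  using assms
  by (simp add: bessel_K_eq_enn2real nn_integral_bessel_kernel_shift nn_integral_eq_integral
      integrable_shifted_kernel enn2real_mult powr_minus)

text \<open>Dropping the nonpositive term \<open>- x\<^sup>2 * exp (- t) / 2\<close> from the
  exponent only increases the integrand. The bound is uniform in \<open>x\<close> and will dominate
  the case \<open>m < 0\<close>.\<close>

lemma powr_mult_bessel_K_le:
  assumes "\<mu> > 0" "x > 0"
  shows "x powr \<mu> * bessel_K \<mu> x \<le> 2 powr (\<mu> - 1) * Gamma \<mu>"
proof -
  have "(LBINT t. exp (\<mu> * t - exp t / 2 - x\<^sup>2 * exp (- t) / 2)) \<le> (LBINT t. exp (\<mu> * t - exp t / 2))"
    by (intro integral_mono integrable_shifted_kernel Gamma_kernel_half assms) auto
  then show ?thesis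
    by (simp add: powr_mult_bessel_K assms Gamma_kernel_half powr_diff)
qed

lemma tendsto_powr_mult_bessel_K:
  assumes "\<mu> > 0"
  shows "((\<lambda>x. x powr \<mu> * bessel_K \<mu> x) \<longlongrightarrow> 2 powr (\<mu> - 1) * Gamma \<mu>) (at_right 0)"
proof -
  have "(\<lambda>n. LBINT t. exp (\<mu> * t - exp t / 2 - (X n)\<^sup>2 * exp (- t) / 2)) \<longlonglongrightarrow> (LBINT t. exp (\<mu> * t - exp t / 2))"
    if "X \<longlonglongrightarrow> 0" for X :: "nat \<Rightarrow> real"
  proof (rule integral_dominated_convergence[OF _ _ Gamma_kernel_half(1)[OF assms]])
    show "AE t in lborel. (\<lambda>n. exp (\<mu> * t - exp t / 2 - (X n)\<^sup>2 * exp (- t) / 2)) \<longlonglongrightarrow> exp (\<mu> * t - exp t / 2)"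
      using that by (intro AE_I2) (auto intro!: tendsto_eq_intros)
  qed auto
  then have "((\<lambda>x. LBINT t. exp (\<mu> * t - exp t / 2 - x\<^sup>2 * exp (- t) / 2)) \<longlongrightarrow> (LBINT t. exp (\<mu> * t - exp t / 2))) (at_right 0)"
    by (auto simp: tendsto_at_iff_sequentially comp_def)
  then have "((\<lambda>x. (LBINT t. exp (\<mu> * t - exp t / 2 - x\<^sup>2 * exp (- t) / 2)) / 2) \<longlongrightarrow> 2 powr (\<mu> - 1) * Gamma \<mu>) (at_right 0)"
    by (auto simp: Gamma_kernel_half assms powr_diff intro!: tendsto_eq_intros)
  then show ?thesis
    by (rule Lim_transform_eventually)
      (auto simp: powr_mult_bessel_K assms eventually_at_right_less intro!: eventually_at_rightI[of 0 1])
qed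

text \<open>The Gamma majorant is integrable at minus infinity only for positive order. Order 0 is
  therefore compared with order 1, using \<open>cosh t \<ge> 1\<close>, and negative orders are
  reflected.\<close>

lemma nn_integral_bessel_kernel_finite:
  assumes "x > 0"
  shows "(\<integral>\<^sup>+t. ennreal (bessel_kernel \<mu> x t) \<partial>lborel) < \<infinity>"
proof -
  have pos: "(\<integral>\<^sup>+t. ennreal (bessel_kernel \<nu> x t) \<partial>lborel) < \<infinity>" if "\<nu> > 0" for \<nu>
    using that assms
    by (simp add: nn_integral_bessel_kernel_shift nn_integral_eq_integral integrable_shifted_kernel
        ennreal_mult' [symmetric])
  have "(\<integral>\<^sup>+t. ennreal (bessel_kernel 0 x t) \<partial>lborel) \<le> (\<integral>\<^sup>+t. ennreal (bessel_kernel 1 x t) \<partial>lborel)"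
    unfolding nn_integral_bessel_kernel
    by (intro mult_left_mono nn_integral_mono mult_right_mono ennreal_leI) (auto simp: cosh_real_ge_1)
  also note pos[of 1]
  finally have "(\<integral>\<^sup>+t. ennreal (bessel_kernel 0 x t) \<partial>lborel) < \<infinity>" by simp
  then show ?thesis
    using pos[of \<mu>] pos[of "- \<mu>"] nn_integral_bessel_kernel_uminus[of \<mu> x]
    by (cases \<mu> "0::real" rule: linorder_cases) auto
qed

lemma ennreal_bessel_K:
  assumes "x > 0"
  shows "ennreal (2 * bessel_K \<mu> x) = (\<integral>\<^sup>+t. ennreal (bessel_kernel \<mu> x t) \<partial>lborel)"
  using nn_integral_bessel_kernel_finite[OF assms, of \<mu>]
  by (simp add: bessel_K_eq_enn2real ennreal_mult')

text \<open>Up to \<open>L = max 0 (- ln x)\<close> the integrand is at most 1; beyond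
  \<open>L\<close> it is at most \<open>exp (- (t - L) / 2)\<close>, whose integral is 2. The
  maximum with 0 keeps the bound valid for every \<open>x > 0\<close>, which matters because it will
  be applied at arguments unbounded in \<open>y\<close>.\<close>

lemma bessel_K_0_le:
  assumes "x > 0"
  shows "bessel_K 0 x \<le> 2 + max 0 (- ln x)"
proof -
  define L where "L = max 0 (- ln x)"
  have xL: "1 \<le> x * exp L"
    using assms by (cases "ln x \<le> 0") (auto simp: L_def max_def exp_minus)
  have le: "exp (- x * cosh t) \<le> exp (- (t - L) / 2)" for t
  proof -
    have "t - L \<le> exp (t - L)" using exp_ge_add_one_self[of "t - L"] by linarith
    also have "\<dots> \<le> exp (t - L) * (x * exp L)" using xL by simp
    also have "\<dots> = x * exp t" by (simp add: exp_diff)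
    also have "\<dots> \<le> 2 * (x * cosh t)" using assms by (simp add: cosh_def)
    finally show ?thesis by simp
  qed
  have "ennreal (2 * bessel_K 0 x) = 2 * (\<integral>\<^sup>+t. ennreal (exp (- x * cosh t)) * indicator {0<..} t \<partial>lborel)"
    using ennreal_bessel_K[OF assms, of 0] by (simp add: nn_integral_bessel_kernel)
  also have "(\<integral>\<^sup>+t. ennreal (exp (- x * cosh t)) * indicator {0<..} t \<partial>lborel) \<le>
      (\<integral>\<^sup>+t. indicator {0..L} t + ennreal (exp (- (t - L) / 2)) * indicator {L..} t \<partial>lborel)"
  proof (intro nn_integral_mono)
    fix t
    have "ennreal (exp (- x * cosh t)) \<le> 1"
      using assms by (simp add: cosh_real_nonneg flip: ennreal_1 del: ennreal_1)
    then show "ennreal (exp (- x * cosh t)) * indicator {0<..} t \<le>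
        indicator {0..L} t + ennreal (exp (- (t - L) / 2)) * indicator {L..} t"
      using ennreal_leI[OF le[of t]] by (auto simp: indicator_def L_def intro: add_increasing2)
  qed
  also have "\<dots> = (\<integral>\<^sup>+t. indicator {0..L} t \<partial>lborel) + (\<integral>\<^sup>+t. ennreal (exp (- (t - L) / 2)) * indicator {L..} t \<partial>lborel)"
    by (rule nn_integral_add) auto
  also have "(\<integral>\<^sup>+t. ennreal (exp (- (t - L) / 2)) * indicator {L..} t \<partial>lborel) = ennreal (0 - (- 2 * exp (- (L - L) / 2)))"
  proof (rule nn_integral_FTC_atLeast[where F = "\<lambda>t. - 2 * exp (- (t - L) / 2)"])
    show "((\<lambda>t. - 2 * exp (- (t - L) / 2)) \<longlongrightarrow> 0) at_top"
    proof -
      have "filterlim (\<lambda>t. - (t - L) / 2) at_bot at_top"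
        unfolding filterlim_at_bot
      proof
        fix Z :: real
        show "\<forall>\<^sub>F t in at_top. - (t - L) / 2 \<le> Z"
          using eventually_ge_at_top[of "L - 2 * Z"] by eventually_elim simp
      qed
      then have "((\<lambda>t. exp (- (t - L) / 2)) \<longlongrightarrow> 0) at_top"
        by (rule filterlim_compose[OF exp_at_bot])
      from tendsto_mult_left[OF this, of "-2"] show ?thesis
        by (simp add: field_simps)
    qed
  qed (auto intro!: derivative_eq_intros)
  also have "(\<integral>\<^sup>+t. indicator {0..L} t \<partial>lborel) = ennreal L"
    by (simp add: L_def)
  also have "2 * (ennreal L + ennreal (0 - (- 2 * exp (- (L - L) / 2)))) = ennreal (2 * (L + 2))"
    by (simp add: ennreal_mult' distrib_left L_def)
  finally have "ennreal (2 * bessel_K 0 x) \<le> ennreal (2 * (L + 2))"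
    by (simp add: mult_left_mono)
  then show ?thesis by (subst (asm) ennreal_le_iff) (auto simp: L_def)
qed

text \<open>For \<open>t > 0\<close> one has \<open>exp (- x * cosh t) \<ge> 1 - x * exp t\<close>.
  The right side is nonnegative up to its zero \<open>L = - ln x\<close> and is integrated only that
  far.\<close>

lemma bessel_K_0_ge:
  assumes "0 < x" "x \<le> 1"
  shows "bessel_K 0 x \<ge> - ln x - 1"
proof -
  define L where "L = - ln x"
  have L: "L \<ge> 0" "exp L = 1 / x" using assms by (auto simp: L_def exp_minus field_simps)
  \<comment> \<open>Since \<open>x * exp L = 1\<close>, the exact value on the right is
    \<open>L - 1 + x\<close>; the positive term \<open>x\<close> is given away.\<close>
  have "ennreal (L - 1) \<le> ennreal ((L - x * exp L) - (0 - x * exp 0))"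
    using assms L by (intro ennreal_leI) auto
  also have "\<dots> = (\<integral>\<^sup>+t. ennreal (1 - x * exp t) * indicator {0..L} t \<partial>lborel)"
  proof (rule nn_integral_FTC_Icc [symmetric])
    fix t assume "t \<in> {0..L}"
    then have "t \<le> L" by simp
    then have "exp t \<le> 1 / x" using L(2) by (metis exp_le_cancel_iff)
    then show "0 \<le> 1 - x * exp t" using assms by (simp add: field_simps)
  qed (use L in \<open>auto intro!: derivative_eq_intros\<close>)
  also have "\<dots> \<le> (\<integral>\<^sup>+t. ennreal (exp (- x * cosh t)) * indicator {0<..} t \<partial>lborel)"
  proof (intro nn_integral_mono_AE, use AE_lborel_singleton[of "0::real"] in eventually_elim)
    fix t :: real assume "t \<noteq> 0"
    have "1 - x * exp t \<le> exp (- x * cosh t)" if "t > 0"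
    proof -
      have "cosh t \<le> exp t" using that by (simp add: cosh_def)
      then have "x * cosh t \<le> x * exp t" using assms by simp
      then show ?thesis using exp_ge_add_one_self[of "- x * cosh t"] by simp
    qed
    then show "ennreal (1 - x * exp t) * indicator {0..L} t \<le> ennreal (exp (- x * cosh t)) * indicator {0<..} t"
      using \<open>t \<noteq> 0\<close> by (auto simp: indicator_def intro: ennreal_leI)
  qed
  finally have "2 * ennreal (L - 1) \<le> ennreal (2 * bessel_K 0 x)"
    using ennreal_bessel_K[OF assms(1), of 0] by (simp add: nn_integral_bessel_kernel mult_left_mono)
  then have "ennreal (L - 1) \<le> ennreal (bessel_K 0 x)"
    by (simp add: ennreal_mult' ennreal_mult_le_mult_iff)
  \<comment> \<open>For \<open>L < 1\<close> the left side has been truncated to 0 by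
    \<open>ennreal\<close>; nonnegativity of the Bessel function covers that case.\<close>
  then show ?thesis using bessel_K_nonneg[of 0 x] by (simp add: L_def ennreal_le_iff)
qed

lemma tendsto_bessel_K_0_div_ln:
  "((\<lambda>x. bessel_K 0 x / - ln x) \<longlongrightarrow> 1) (at_right 0)"
proof (rule tendsto_sandwich)
  have ev: "\<forall>\<^sub>F x::real in at_right 0. 0 < x \<and> x < 1"
    by (auto intro!: eventually_at_rightI[of 0 1])
  show "\<forall>\<^sub>F x in at_right 0. 1 + 1 / ln x \<le> bessel_K 0 x / - ln x"
    using ev
  proof eventually_elim
    case (elim x)
    then have L: "- ln x > 0" by simp
    have "(- ln x - 1) / - ln x \<le> bessel_K 0 x / - ln x"
      using bessel_K_0_ge[of x] elim L by (intro divide_right_mono) auto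
    with L show ?case by (simp add: diff_divide_distrib)
  qed
  show "\<forall>\<^sub>F x in at_right 0. bessel_K 0 x / - ln x \<le> 1 - 2 / ln x"
    using ev
  proof eventually_elim
    case (elim x)
    then have L: "- ln x > 0" by simp
    have "bessel_K 0 x / - ln x \<le> (2 - ln x) / - ln x"
      using bessel_K_0_le[of x] elim L by (intro divide_right_mono) auto
    with L show ?case by (simp add: diff_divide_distrib)
  qed
  have inv: "((\<lambda>x::real. c / ln x) \<longlongrightarrow> 0) (at_right 0)" for c
    by (intro tendsto_divide_0[OF tendsto_const] filterlim_at_bot_imp_at_infinity ln_at_0)
  show "((\<lambda>x::real. 1 + 1 / ln x) \<longlongrightarrow> 1) (at_right 0)" "((\<lambda>x::real. 1 - 2 / ln x) \<longlongrightarrow> 1) (at_right 0)"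
    using tendsto_add[OF tendsto_const[of 1] inv[of 1]] tendsto_diff[OF tendsto_const[of 1] inv[of 2]] by auto
qed

text \<open>In the coordinates \<open>p = ln x + t\<close>, \<open>q = ln x - t\<close> the double integral splits into two Gamma integrals.\<close>

lemma nn_integral_bessel_K_Mellin:
  fixes s n \<alpha> :: real
  assumes "s > \<bar>n\<bar>" "\<alpha> > 0"
  shows "(\<integral>\<^sup>+x. ennreal (x powr (s - 1) * bessel_K n (\<alpha> * x)) * indicator {0<..} x \<partial>lborel) =
     ennreal (Gamma ((s + n) / 2) * Gamma ((s - n) / 2) * (\<alpha> / 2) powr (- s) / 4)"
proof -
  define G where "G a = (\<integral>\<^sup>+t. ennreal (exp (a * t - \<alpha> / 2 * exp t)) \<partial>lborel)" for a
  have "2 * (\<integral>\<^sup>+x. ennreal (x powr (s - 1) * bessel_K n (\<alpha> * x)) * indicator {0<..} x \<partial>lborel)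
      = 2 * (\<integral>\<^sup>+r. ennreal (exp r powr (s - 1) * bessel_K n (\<alpha> * exp r) * exp r) \<partial>lborel)"
    by (subst nn_integral_exp_substitution) auto
  also have "\<dots> = (\<integral>\<^sup>+r. 2 * ennreal (exp r powr (s - 1) * bessel_K n (\<alpha> * exp r) * exp r) \<partial>lborel)"
    by (rule nn_integral_cmult [symmetric]) auto
  also have "\<dots> = (\<integral>\<^sup>+r. \<integral>\<^sup>+t. ennreal (exp (s * r + n * t - \<alpha> * exp r * cosh t)) \<partial>lborel \<partial>lborel)"
  proof (intro nn_integral_cong)
    fix r
    have "2 * ennreal (exp r powr (s - 1) * bessel_K n (\<alpha> * exp r) * exp r) =
        ennreal (exp (s * r)) * ennreal (2 * bessel_K n (\<alpha> * exp r))"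
      by (simp add: ennreal_mult' [symmetric] powr_def exp_add [symmetric] algebra_simps
          flip: ennreal_numeral)
    also have "\<dots> = (\<integral>\<^sup>+t. ennreal (exp (s * r)) * ennreal (bessel_kernel n (\<alpha> * exp r) t) \<partial>lborel)"
      using assms by (simp add: ennreal_bessel_K nn_integral_cmult)
    finally show "2 * ennreal (exp r powr (s - 1) * bessel_K n (\<alpha> * exp r) * exp r) =
        (\<integral>\<^sup>+t. ennreal (exp (s * r + n * t - \<alpha> * exp r * cosh t)) \<partial>lborel)"
      by (simp add: bessel_kernel_def ennreal_mult' [symmetric] exp_add [symmetric] algebra_simps)
  qed
  also have "\<dots> = (\<integral>\<^sup>+t. \<integral>\<^sup>+r. ennreal (exp (s * r + n * t - \<alpha> * exp r * cosh t)) \<partial>lborel \<partial>lborel)"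
    by (rule lborel_pair.Fubini') (unfold cosh_def, measurable)
  \<comment> \<open>The planar change of variables is carried out as two affine changes in one
    variable, the other being frozen, with an exchange of the integrals in between.\<close>
  also have "\<dots> = (\<integral>\<^sup>+t. \<integral>\<^sup>+p. ennreal (exp (s * (- t + p) + n * t - \<alpha> * exp (- t + p) * cosh t)) \<partial>lborel \<partial>lborel)"
  proof (rule nn_integral_cong)
    fix t :: real
    show "(\<integral>\<^sup>+r. ennreal (exp (s * r + n * t - \<alpha> * exp r * cosh t)) \<partial>lborel) =
        (\<integral>\<^sup>+p. ennreal (exp (s * (- t + p) + n * t - \<alpha> * exp (- t + p) * cosh t)) \<partial>lborel)"
      by (subst nn_integral_real_affine[where c=1 and t="- t"]) auto
  qed
  also have "\<dots> = (\<integral>\<^sup>+p. \<integral>\<^sup>+t. ennreal (exp (s * (- t + p) + n * t - \<alpha> * exp (- t + p) * cosh t)) \<partial>lborel \<partial>lborel)"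
    by (rule lborel_pair.Fubini') (unfold cosh_def, measurable)
  also have "\<dots> = (\<integral>\<^sup>+p. ennreal (1/2) * (\<integral>\<^sup>+q. ennreal (exp ((s + n) / 2 * p - \<alpha> / 2 * exp p)) *
       ennreal (exp ((s - n) / 2 * q - \<alpha> / 2 * exp q)) \<partial>lborel) \<partial>lborel)"
  proof (intro nn_integral_cong)
    fix p
    \<comment> \<open>This is the decoupling:
      \<open>exp (p - t) * cosh t = (exp p + exp q) / 2\<close> because
      \<open>q = p - 2 * t\<close>. The Jacobian of \<open>t = (p - q) / 2\<close> is the prefactor
      \<open>1/2\<close>.\<close>
    have "s * (- t + p) + n * t - \<alpha> * exp (- t + p) * cosh t =
        (s + n) / 2 * p - \<alpha> / 2 * exp p + ((s - n) / 2 * q - \<alpha> / 2 * exp q)"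
      if "t = p / 2 + (- 1/2) * q" for q t
    proof -
      have "exp (- t + p) * exp t = exp p" by (simp flip: exp_add)
      moreover have "exp (- t + p) * exp (- t) = exp q" using that by (simp flip: exp_add)
      ultimately have "exp (- t + p) * cosh t = exp p / 2 + exp q / 2"
        by (simp add: cosh_def field_simps)
      then have "\<alpha> * exp (- t + p) * cosh t = \<alpha> / 2 * exp p + \<alpha> / 2 * exp q"
        by (simp add: mult.assoc distrib_left)
      moreover have "s * (- t + p) + n * t = (s + n) / 2 * p + (s - n) / 2 * q"
        unfolding that by (simp add: field_simps)
      ultimately show ?thesis by linarith
    qed
    then show "(\<integral>\<^sup>+t. ennreal (exp (s * (- t + p) + n * t - \<alpha> * exp (- t + p) * cosh t)) \<partial>lborel) =
       ennreal (1/2) * (\<integral>\<^sup>+q. ennreal (exp ((s + n) / 2 * p - \<alpha> / 2 * exp p)) *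
       ennreal (exp ((s - n) / 2 * q - \<alpha> / 2 * exp q)) \<partial>lborel)"
      by (subst nn_integral_real_affine[where c="-1/2" and t="p / 2"])
        (auto simp: ennreal_mult' [symmetric] exp_add cosh_def)
  qed
  also have "\<dots> = ennreal (1/2) * (G ((s + n) / 2) * G ((s - n) / 2))"
    unfolding G_def by (simp add: nn_integral_cmult nn_integral_multc)
  also have "\<dots> = ennreal (1/2 * ((Gamma ((s + n) / 2) * (\<alpha> / 2) powr (- ((s + n) / 2))) *
      (Gamma ((s - n) / 2) * (\<alpha> / 2) powr (- ((s - n) / 2)))))"
  proof -
    have "G a = ennreal (Gamma a * (\<alpha> / 2) powr - a)" "0 \<le> Gamma a * (\<alpha> / 2) powr - a" if "a > 0" for a
      using nn_integral_Gamma_exp[OF that, of "\<alpha> / 2"] that assms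
      by (simp_all add: G_def Gamma_real_pos less_imp_le)
    moreover have "(s + n) / 2 > 0" "(s - n) / 2 > 0" using assms by auto
    ultimately show ?thesis
      by (simp only: ennreal_mult mult_nonneg_nonneg zero_le_divide_1_iff zero_le_numeral)
  qed
  also have "\<dots> = ennreal (2 * (Gamma ((s + n) / 2) * Gamma ((s - n) / 2) * (\<alpha> / 2) powr (- s) / 4))"
    using powr_add[of "\<alpha> / 2" "- ((s + n) / 2)" "- ((s - n) / 2)"]
    by (simp add: field_simps)
  also have "\<dots> = 2 * ennreal (Gamma ((s + n) / 2) * Gamma ((s - n) / 2) * (\<alpha> / 2) powr (- s) / 4)"
    by (subst ennreal_mult') auto
  finally show ?thesis
    by (simp only: ennreal_mult_cancel_left) simp
qed

section \<open>Hypergeometric series and absolute moments of Bessel functions\<close>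

text \<open>Ratio test: the quotient \<open>q k\<close> of consecutive terms tends to
  \<open>x\<close>, and \<open>(1 + x) / 2\<close> lies strictly between \<open>x\<close> and
  1.\<close>

lemma summable_hyp2F1:
  fixes a b c x :: real
  assumes "0 \<le> x" "x < 1" "a > 0" "b > 0" "c > 0"
  shows "summable (\<lambda>k. pochhammer a k * pochhammer b k / pochhammer c k * (x ^ k / fact k))"
proof -
  define u where "u k = pochhammer a k * pochhammer b k / pochhammer c k * (x ^ k / fact k)" for k
  define q where "q k = (a + real k) / (c + real k) * ((b + real k) / (1 + real k)) * x" for k
  have lim: "(\<lambda>k. (d + real k) / (e + real k)) \<longlonglongrightarrow> 1" if "e > 0" for d e :: real
  proof -
    have "filterlim (\<lambda>k. e + real k) at_top sequentially"
      by (intro filterlim_tendsto_add_at_top[OF tendsto_const] filterlim_real_sequentially)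
    then have "(\<lambda>k. 1 + (d - e) / (e + real k)) \<longlonglongrightarrow> 1 + 0"
      by (intro tendsto_add tendsto_const real_tendsto_divide_at_top[OF tendsto_const])
    moreover have "1 + (d - e) / (e + real k) = (d + real k) / (e + real k)" for k
      using that by (simp add: field_simps add_pos_nonneg)
    ultimately show ?thesis by simp
  qed
  have "q \<longlonglongrightarrow> 1 * 1 * x"
    unfolding q_def using assms by (intro tendsto_mult lim tendsto_const) auto
  then have "\<forall>\<^sub>F k in sequentially. q k < (1 + x) / 2"
    using assms by (intro order_tendstoD(2)) auto
  then obtain N where N: "\<And>k. k \<ge> N \<Longrightarrow> q k < (1 + x) / 2"
    by (auto simp: eventually_sequentially)
  have u: "u k \<ge> 0" for k
    using assms by (auto simp: u_def intro!: mult_nonneg_nonneg divide_nonneg_nonneg less_imp_le[OF pochhammer_pos])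
  have "u (Suc k) = q k * u k" for k
    using assms by (simp add: u_def q_def pochhammer_Suc mult_ac)
  then have "norm (u (Suc k)) \<le> (1 + x) / 2 * norm (u k)" if "k \<ge> N" for k
    using u[of k] u[of "Suc k"] mult_right_mono[OF less_imp_le[OF N[OF that]], of "u k"] by auto
  then have "summable u"
    using assms by (intro summable_ratio_test[of "(1 + x) / 2" N]) auto
  then show ?thesis unfolding u_def [symmetric] .
qed

text \<open>All terms are nonnegative and the first is 1. Positivity makes the leading coefficients
  nonzero, without which a limit of quotients would not give an asymptotic equivalence.\<close>

lemma hyp2F1_pos:
  assumes "0 \<le> x" "x < 1" "a > 0" "b > 0" "c > 0"
  shows "hyp2F1 a b c x > 0"
  unfolding hyp2F1_def
  by (rule suminf_pos2[OF summable_hyp2F1[OF assms], of 0])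
    (use assms in \<open>auto intro!: mult_nonneg_nonneg divide_nonneg_nonneg less_imp_le[OF pochhammer_pos]\<close>)

lemma cosh_sums_even:
  fixes x :: real
  shows "(\<lambda>k. x ^ (2 * k) / fact (2 * k)) sums cosh x"
proof -
  have "(\<lambda>k. if even (2 * k) then x ^ (2 * k) / fact (2 * k) else 0) sums cosh x"
    by (subst sums_mono_reindex[of "\<lambda>k. 2 * k" "\<lambda>n. if even n then x ^ n / fact n else 0"])
      (use cosh_converges[of x] in \<open>auto simp: strict_mono_def divide_inverse mult.commute image_iff scaleR_conv_of_real if_distrib cong: if_cong elim!: evenE\<close>)
  then show ?thesis by simp
qed

text \<open>Folding at 0 replaces \<open>exp (b * y)\<close> by \<open>2 * cosh (b * y)\<close>, so
  only even powers of \<open>y\<close> survive. The remaining series has nonnegative terms and is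
  integrated termwise. The exponent is written as \<open>2 * a + n - 1\<close> so that the Mellin
  transform produces exactly \<open>Gamma (a + k)\<close> and
  \<open>Gamma (a + n + k)\<close>.\<close>

lemma nn_integral_abs_powr_exp_bessel_K:
  fixes a n b \<alpha> :: real
  assumes "a > 0" "a + n > 0" "\<bar>b\<bar> < \<alpha>"
  shows "(\<integral>\<^sup>+y. ennreal (\<bar>y\<bar> powr (2 * a + n - 1) * exp (b * y) * bessel_K n (\<alpha> * \<bar>y\<bar>)) \<partial>lborel) =
    ennreal (2 powr (2 * a + n - 1) * \<alpha> powr - (2 * a + n) * (Gamma a * Gamma (a + n)) *
      hyp2F1 a (a + n) (1/2) (b\<^sup>2 / \<alpha>\<^sup>2))"
proof -
  define h where "h y = \<bar>y\<bar> powr (2 * a + n - 1) * bessel_K n (\<alpha> * \<bar>y\<bar>)" for y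
  have h0: "h y \<ge> 0" for y by (simp add: h_def)
  have h [measurable]: "h \<in> borel_measurable borel" unfolding h_def by measurable
  have \<alpha>: "\<alpha> > 0" and b\<alpha>: "b\<^sup>2 / \<alpha>\<^sup>2 < 1"
    using assms abs_ge_zero[of b] by (linarith, simp add: abs_square_less_1 flip: power_divide)
  define C where "C = 2 powr (2 * a + n - 1) * \<alpha> powr - (2 * a + n) * (Gamma a * Gamma (a + n))"
  define u where "u k = pochhammer a k * pochhammer (a + n) k / pochhammer (1/2) k * ((b\<^sup>2 / \<alpha>\<^sup>2) ^ k / fact k)" for k
  have "(\<integral>\<^sup>+y. ennreal (\<bar>y\<bar> powr (2 * a + n - 1) * exp (b * y) * bessel_K n (\<alpha> * \<bar>y\<bar>)) \<partial>lborel)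
     = (\<integral>\<^sup>+y. ennreal (h y * exp (b * y)) * indicator {0<..} y + ennreal (h y * exp (b * y)) * indicator {..<0} y \<partial>lborel)"
    by (intro nn_integral_cong_AE, use AE_lborel_singleton[of "0::real"] in eventually_elim)
      (auto simp: indicator_def h_def mult_ac)
  also have "\<dots> = (\<integral>\<^sup>+y. ennreal (h y * exp (b * y)) * indicator {0<..} y \<partial>lborel)
        + (\<integral>\<^sup>+y. ennreal (h y * exp (b * y)) * indicator {..<0} y \<partial>lborel)"
    by (rule nn_integral_add) auto
  also have "(\<integral>\<^sup>+y. ennreal (h y * exp (b * y)) * indicator {..<0} y \<partial>lborel) =
      (\<integral>\<^sup>+y. ennreal (h y * exp (- b * y)) * indicator {0<..} y \<partial>lborel)"
    by (subst nn_integral_real_affine[where c="-1" and t=0])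
      (auto simp: indicator_def h_def intro!: nn_integral_cong)
  also have "(\<integral>\<^sup>+y. ennreal (h y * exp (b * y)) * indicator {0<..} y \<partial>lborel) + \<dots> =
      (\<integral>\<^sup>+y. ennreal (h y * exp (b * y)) * indicator {0<..} y + ennreal (h y * exp (- b * y)) * indicator {0<..} y \<partial>lborel)"
    by (rule nn_integral_add [symmetric]) auto
  also have "\<dots> = (\<integral>\<^sup>+y. (\<Sum>k. ennreal (h y * 2 * ((b * y) ^ (2 * k) / fact (2 * k))) * indicator {0<..} y) \<partial>lborel)"
  proof (intro nn_integral_cong)
    fix y :: real
    have s: "(\<lambda>k. h y * 2 * ((b * y) ^ (2 * k) / fact (2 * k))) sums (h y * 2 * cosh (b * y))"
      by (intro sums_mult cosh_sums_even)
    have "ennreal (h y * exp (b * y)) + ennreal (h y * exp (- b * y)) = ennreal (h y * 2 * cosh (b * y))"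
      using h0[of y] by (simp add: cosh_def field_simps flip: ennreal_plus)
    also have "\<dots> = (\<Sum>k. ennreal (h y * 2 * ((b * y) ^ (2 * k) / fact (2 * k))))"
      using s h0[of y] by (subst suminf_ennreal2) (auto simp: sums_iff)
    finally show "ennreal (h y * exp (b * y)) * indicator {0<..} y + ennreal (h y * exp (- b * y)) * indicator {0<..} y
       = (\<Sum>k. ennreal (h y * 2 * ((b * y) ^ (2 * k) / fact (2 * k))) * indicator {0<..} y)"
      by (simp add: indicator_def)
  qed
  also have "\<dots> = (\<Sum>k. \<integral>\<^sup>+y. ennreal (h y * 2 * ((b * y) ^ (2 * k) / fact (2 * k))) * indicator {0<..} y \<partial>lborel)"
    by (rule nn_integral_suminf) auto
  also have "\<dots> = (\<Sum>k. ennreal (C * u k))"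
  proof (intro suminf_cong)
    fix k
    \<comment> \<open>With this choice \<open>(s - n) / 2 = a + k\<close> and
      \<open>(s + n) / 2 = a + n + k\<close>; both are positive, which is the condition
      \<open>s > \<bar>n\<bar>\<close> of the Mellin transform.\<close>
    define s where "s = 2 * a + n + 2 * real k"
    define D where "D = 2 * b ^ (2 * k) / fact (2 * k)"
    have D0: "D \<ge> 0" by (simp add: D_def)
    have "(\<integral>\<^sup>+y. ennreal (h y * 2 * ((b * y) ^ (2 * k) / fact (2 * k))) * indicator {0<..} y \<partial>lborel) =
       (\<integral>\<^sup>+y. ennreal D * (ennreal (y powr (s - 1) * bessel_K n (\<alpha> * y)) * indicator {0<..} y) \<partial>lborel)"
    proof (intro nn_integral_cong)
      fix y :: real
      have "h y * 2 * ((b * y) ^ (2 * k) / fact (2 * k)) = D * (y powr (s - 1) * bessel_K n (\<alpha> * y))" if "y > 0"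
      proof -
        have "y powr (s - 1) = y powr (2 * a + n - 1) * y ^ (2 * k)"
          using that by (simp add: s_def powr_add [symmetric] algebra_simps flip: powr_realpow)
        then show ?thesis using that by (simp add: h_def D_def power_mult_distrib)
      qed
      then show "ennreal (h y * 2 * ((b * y) ^ (2 * k) / fact (2 * k))) * indicator {0<..} y =
         ennreal D * (ennreal (y powr (s - 1) * bessel_K n (\<alpha> * y)) * indicator {0<..} y)"
        using D0 by (auto simp: indicator_def ennreal_mult')
    qed
    also have "\<dots> = ennreal D * (\<integral>\<^sup>+y. ennreal (y powr (s - 1) * bessel_K n (\<alpha> * y)) * indicator {0<..} y \<partial>lborel)"
      by (rule nn_integral_cmult) auto
    also have "\<dots> = ennreal (D * (Gamma ((s + n) / 2) * Gamma ((s - n) / 2) * (\<alpha> / 2) powr (- s) / 4))"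
      using assms \<alpha> D0 by (subst nn_integral_bessel_K_Mellin) (auto simp: s_def abs_if simp flip: ennreal_mult')
    also have "D * (Gamma ((s + n) / 2) * Gamma ((s - n) / 2) * (\<alpha> / 2) powr (- s) / 4) = C * u k"
    proof -
      have ne: "a \<notin> \<int>\<^sub>\<le>\<^sub>0" "a + n \<notin> \<int>\<^sub>\<le>\<^sub>0" using assms by (auto dest: nonpos_Ints_nonpos)
      have ne': "Gamma a \<noteq> 0" "Gamma (a + n) \<noteq> 0"
        using Gamma_real_pos assms by (metis less_irrefl)+
      have e: "(s - n) / 2 = a + real k" by (simp add: s_def field_simps)
      have g1: "Gamma ((s - n) / 2) = Gamma a * pochhammer a k"
        unfolding e using ne' by (simp add: pochhammer_Gamma[OF ne(1)])
      have e': "(s + n) / 2 = a + n + real k" by (simp add: s_def field_simps)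
      have g2: "Gamma ((s + n) / 2) = Gamma (a + n) * pochhammer (a + n) k"
        unfolding e' using ne' by (simp add: pochhammer_Gamma[OF ne(2)])
      have "(\<alpha> / 2) powr (- s) = (\<alpha> / 2) powr (- (2 * a + n)) * (\<alpha> / 2) powr (- real (2 * k))"
        by (simp add: s_def powr_add [symmetric])
      also have "(\<alpha> / 2) powr (- real (2 * k)) = 2 ^ (2 * k) / \<alpha> ^ (2 * k)"
        using \<alpha> by (subst powr_minus, subst powr_realpow) (auto simp: power_divide)
      also have "(\<alpha> / 2) powr (- (2 * a + n)) = 2 * 2 powr (2 * a + n - 1) * \<alpha> powr - (2 * a + n)"
        using \<alpha> by (simp add: powr_divide powr_minus powr_diff powr_add field_simps)
      finally have p: "(\<alpha> / 2) powr (- s) = 2 * 2 powr (2 * a + n - 1) * \<alpha> powr - (2 * a + n) * (2 ^ (2 * k) / \<alpha> ^ (2 * k))" .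
      \<comment> \<open>This is the origin of the lower parameter \<open>1/2\<close>; the power of 2
        cancels against the one from \<open>(\<alpha> / 2) powr (- s)\<close>.\<close>
      have f: "fact (2 * k) = 2 ^ (2 * k) * pochhammer (1/2) k * (fact k :: real)"
        by (rule fact_double)
      have v: "(b\<^sup>2 / \<alpha>\<^sup>2) ^ k = b ^ (2 * k) / \<alpha> ^ (2 * k)"
        by (simp add: power_divide power_mult)
      have pp: "pochhammer (1/2) k \<noteq> (0::real)" using pochhammer_pos[of "1/2::real" k] by simp
      show ?thesis
        unfolding D_def C_def u_def g1 g2 p f v using \<alpha> pp by (simp add: field_simps)
    qed
    finally show "(\<integral>\<^sup>+y. ennreal (h y * 2 * ((b * y) ^ (2 * k) / fact (2 * k))) * indicator {0<..} y \<partial>lborel) = ennreal (C * u k)" .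
  qed
  also have "\<dots> = ennreal (\<Sum>k. C * u k)"
  proof (rule suminf_ennreal2)
    have sm: "summable u" unfolding u_def using assms b\<alpha> by (intro summable_hyp2F1) auto
    then show "summable (\<lambda>k. C * u k)" by (rule summable_mult)
    show "0 \<le> C * u k" for k
      using assms unfolding C_def u_def
      by (intro mult_nonneg_nonneg divide_nonneg_nonneg less_imp_le[OF pochhammer_pos] less_imp_le[OF Gamma_real_pos]) auto
  qed
  also have "(\<Sum>k. C * u k) = C * hyp2F1 a (a + n) (1/2) (b\<^sup>2 / \<alpha>\<^sup>2)"
    unfolding hyp2F1_def u_def using assms b\<alpha> by (intro suminf_mult summable_hyp2F1) auto
  finally show ?thesis by (simp add: C_def)
qed

section \<open>The density of a ratio\<close>

text \<open>For fixed \<open>y \<noteq> 0\<close> the substitution \<open>x = y * z\<close> has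
  Jacobian \<open>\<bar>y\<bar>\<close>; Tonelli then makes \<open>z\<close> the outer
  variable.\<close>

lemma distributed_ratio_density:
  fixes X Y :: "'a \<Rightarrow> real"
  assumes "prob_space M"
    and X: "distributed M lborel X (\<lambda>x. ennreal (f x))" and Y: "distributed M lborel Y (\<lambda>x. ennreal (g x))"
    and indep: "prob_space.indep_var M borel X borel Y"
    and [measurable]: "f \<in> borel_measurable borel" "g \<in> borel_measurable borel"
    and nn: "\<And>x. f x \<ge> 0" "\<And>y. g y \<ge> 0"
  shows "distributed M lborel (\<lambda>\<omega>. X \<omega> / Y \<omega>) (\<lambda>z. ennreal (ratio_density f g z))"
proof -
  interpret prob_space M by fact
  define h where "h z = (\<integral>\<^sup>+y. ennreal (\<bar>y\<bar> * f (y * z) * g y) \<partial>lborel)" for z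
  have h_meas [measurable]: "h \<in> borel_measurable borel" unfolding h_def by measurable
  have [measurable]: "X \<in> borel_measurable M" "Y \<in> borel_measurable M"
    using X Y by (auto dest: distributed_measurable)
  have "indep_var lborel X lborel Y" using indep by (simp add: indep_var_eq)
  then have J: "distributed M (lborel \<Otimes>\<^sub>M lborel) (\<lambda>\<omega>. (X \<omega>, Y \<omega>)) (\<lambda>(x, y). ennreal (f x) * ennreal (g y))"
    by (intro distributed_joint_indep X Y) (auto intro: lborel.sigma_finite_measure_axioms)
  have distr_eq: "distr M lborel (\<lambda>\<omega>. X \<omega> / Y \<omega>) = density lborel h"
  proof (rule measure_eqI)
    fix A assume "A \<in> sets (distr M lborel (\<lambda>\<omega>. X \<omega> / Y \<omega>))"
    then have [measurable]: "A \<in> sets borel" by simp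
    have "emeasure (distr M lborel (\<lambda>\<omega>. X \<omega> / Y \<omega>)) A = (\<integral>\<^sup>+\<omega>. indicator A (X \<omega> / Y \<omega>) \<partial>M)"
      by (subst nn_integral_indicator [symmetric], simp, subst nn_integral_distr) auto
    also have "\<dots> = (\<integral>\<^sup>+p. (case p of (x, y) \<Rightarrow> ennreal (f x) * ennreal (g y)) * (case p of (x, y) \<Rightarrow> indicator A (x / y)) \<partial>(lborel \<Otimes>\<^sub>M lborel))"
      by (subst distributed_nn_integral[OF J]) auto
    also have "\<dots> = (\<integral>\<^sup>+y. \<integral>\<^sup>+x. ennreal (f x) * ennreal (g y) * indicator A (x / y) \<partial>lborel \<partial>lborel)"
      by (subst lborel_pair.nn_integral_snd [symmetric]) auto
    \<comment> \<open>The point \<open>y = 0\<close>, where \<open>x / y\<close> has the default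
      value 0, is a null set.\<close>
    also have "\<dots> = (\<integral>\<^sup>+y. \<integral>\<^sup>+z. ennreal (\<bar>y\<bar> * f (y * z) * g y) * indicator A z \<partial>lborel \<partial>lborel)"
    proof (rule nn_integral_cong_AE, use AE_lborel_singleton[of "0::real"] in eventually_elim)
      fix y :: real assume y: "y \<noteq> 0"
      have "(\<integral>\<^sup>+x. ennreal (f x) * ennreal (g y) * indicator A (x / y) \<partial>lborel) =
         ennreal \<bar>y\<bar> * (\<integral>\<^sup>+z. ennreal (f (0 + y * z)) * ennreal (g y) * indicator A ((0 + y * z) / y) \<partial>lborel)"
        using y by (subst nn_integral_real_affine[where c=y and t=0]) auto
      also have "\<dots> = (\<integral>\<^sup>+z. ennreal \<bar>y\<bar> * (ennreal (f (0 + y * z)) * ennreal (g y) * indicator A ((0 + y * z) / y)) \<partial>lborel)"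
        by (rule nn_integral_cmult [symmetric]) auto
      also have "\<dots> = (\<integral>\<^sup>+z. ennreal (\<bar>y\<bar> * f (y * z) * g y) * indicator A z \<partial>lborel)"
        using y nn by (intro nn_integral_cong) (auto simp: ennreal_mult mult_ac)
      finally show "(\<integral>\<^sup>+x. ennreal (f x) * ennreal (g y) * indicator A (x / y) \<partial>lborel) =
         (\<integral>\<^sup>+z. ennreal (\<bar>y\<bar> * f (y * z) * g y) * indicator A z \<partial>lborel)" .
    qed
    also have "\<dots> = (\<integral>\<^sup>+z. \<integral>\<^sup>+y. ennreal (\<bar>y\<bar> * f (y * z) * g y) * indicator A z \<partial>lborel \<partial>lborel)"
      by (rule lborel_pair.Fubini') measurable
    also have "\<dots> = (\<integral>\<^sup>+z. h z * indicator A z \<partial>lborel)"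
      unfolding h_def by (intro nn_integral_cong nn_integral_multc) auto
    also have "\<dots> = emeasure (density lborel h) A"
      by (simp add: emeasure_density)
    finally show "emeasure (distr M lborel (\<lambda>\<omega>. X \<omega> / Y \<omega>)) A = emeasure (density lborel h) A" .
  qed simp
  have "(\<integral>\<^sup>+z. h z \<partial>lborel) = emeasure (density lborel h) (space lborel)"
    by (simp add: emeasure_density)
  also have "\<dots> = 1"
    using prob_space.emeasure_space_1[OF prob_space_distr[of "\<lambda>\<omega>. X \<omega> / Y \<omega>" lborel]]
    by (simp add: distr_eq)
  \<comment> \<open>\<open>ratio_density\<close> is a Bochner integral, hence 0 wherever
    \<open>h\<close> is infinite. Total mass 1 confines those points to a null set, so both
    functions define the same density.\<close>
  finally have "AE z in lborel. h z \<noteq> \<infinity>"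
    by (intro nn_integral_PInf_AE) auto
  then have "AE z in lborel. ennreal (ratio_density f g z) = h z"
  proof eventually_elim
    case (elim z)
    have "ratio_density f g z = enn2real (h z)"
      unfolding ratio_density_def h_def using nn by (intro integral_eq_nn_integral) auto
    with elim show ?case by (simp add: less_top)
  qed
  moreover have [measurable]: "ratio_density f g \<in> borel_measurable borel"
    unfolding ratio_density_def by measurable
  ultimately have "density lborel (\<lambda>z. ennreal (ratio_density f g z)) = density lborel h"
    by (intro density_cong) auto
  then show ?thesis
    unfolding distributed_def distr_eq by simp
qed

text \<open>Dominated convergence in the form shared by the cases \<open>m = 0\<close> and
  \<open>m < 0\<close>: \<open>w\<close> is the scale, \<open>- ln \<bar>z\<bar>\<close> or
  \<open>\<bar>z\<bar> powr (2 * m)\<close>, and \<open>p\<close> is the power of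
  \<open>\<bar>y\<bar>\<close> that remains.\<close>

lemma tendsto_ratio_density:
  fixes f g D w :: "real \<Rightarrow> real"
  assumes [measurable]: "f \<in> borel_measurable borel" "g \<in> borel_measurable borel"
    and lim: "\<And>y. y \<noteq> 0 \<Longrightarrow> ((\<lambda>z. f (y * z) / w z) \<longlongrightarrow> c * \<bar>y\<bar> powr p) (at 0)"
    and "\<delta> > 0"
    and bound: "\<And>y z. y \<noteq> 0 \<Longrightarrow> z \<noteq> 0 \<Longrightarrow> \<bar>z\<bar> < \<delta> \<Longrightarrow> \<bar>f (y * z) / w z\<bar> \<le> D y"
    and int: "integrable lborel (\<lambda>y. \<bar>y\<bar> * D y * \<bar>g y\<bar>)"
  shows "((\<lambda>z. ratio_density f g z / w z) \<longlongrightarrow> c * (LBINT y. \<bar>y\<bar> powr (p + 1) * g y)) (at 0)"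
  unfolding tendsto_at_iff_sequentially
proof (intro allI impI)
  fix Z :: "nat \<Rightarrow> real"
  assume Z: "\<forall>i. Z i \<in> UNIV - {0}" "Z \<longlonglongrightarrow> 0"
  have "\<forall>\<^sub>F i in sequentially. \<bar>Z i\<bar> < \<delta>"
    using order_tendstoD(2)[OF tendsto_rabs_zero[OF Z(2)] \<open>\<delta> > 0\<close>] .
  \<comment> \<open>The bound holds only for small \<open>z\<close>, whereas dominated convergence
    asks for it at every index; the sequence is therefore started at \<open>N\<close>.\<close>
  then obtain N where N: "\<And>i. i \<ge> N \<Longrightarrow> \<bar>Z i\<bar> < \<delta>"
    by (auto simp: eventually_sequentially)
  have "(\<lambda>i. LBINT y. \<bar>y\<bar> * f (y * Z (i + N)) * g y / w (Z (i + N))) \<longlonglongrightarrow> (LBINT y. c * (\<bar>y\<bar> powr (p + 1) * g y))"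
  proof (rule integral_dominated_convergence[OF _ _ int])
    show "AE y in lborel. (\<lambda>i. \<bar>y\<bar> * f (y * Z (i + N)) * g y / w (Z (i + N))) \<longlonglongrightarrow> c * (\<bar>y\<bar> powr (p + 1) * g y)"
      using AE_lborel_singleton[of "0::real"]
    proof eventually_elim
      case (elim y)
      have "(\<lambda>i. f (y * Z i) / w (Z i)) \<longlonglongrightarrow> c * \<bar>y\<bar> powr p"
        using lim[OF elim] Z unfolding tendsto_at_iff_sequentially comp_def by blast
      from tendsto_mult[OF tendsto_const LIMSEQ_ignore_initial_segment[OF this], of "\<bar>y\<bar> * g y" N]
      show ?case using elim by (simp add: powr_add mult_ac)
    qed
    show "AE y in lborel. norm (\<bar>y\<bar> * f (y * Z (i + N)) * g y / w (Z (i + N))) \<le> \<bar>y\<bar> * D y * \<bar>g y\<bar>" for i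
      using AE_lborel_singleton[of "0::real"]
    proof eventually_elim
      case (elim y)
      have "\<bar>f (y * Z (i + N)) / w (Z (i + N))\<bar> \<le> D y"
        using Z N[of "i + N"] elim by (intro bound) auto
      then have "\<bar>y\<bar> * \<bar>f (y * Z (i + N)) / w (Z (i + N))\<bar> * \<bar>g y\<bar> \<le> \<bar>y\<bar> * D y * \<bar>g y\<bar>"
        by (intro mult_right_mono mult_left_mono) auto
      then show ?case by (simp add: abs_mult mult_ac)
    qed
  qed auto
  then have "(\<lambda>i. ratio_density f g (Z (i + N)) / w (Z (i + N))) \<longlonglongrightarrow> c * (LBINT y. \<bar>y\<bar> powr (p + 1) * g y)"
    by (simp add: ratio_density_def)
  then show "((\<lambda>z. ratio_density f g z / w z) \<circ> Z) \<longlonglongrightarrow> c * (LBINT y. \<bar>y\<bar> powr (p + 1) * g y)"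
    unfolding comp_def by (rule LIMSEQ_offset)
qed

section \<open>Variance-gamma densities near the origin\<close>

definition vg_const :: "real \<Rightarrow> real \<Rightarrow> real \<Rightarrow> real" where
  "vg_const m \<alpha> \<beta> = vg_gamma \<alpha> \<beta> powr (2 * m + 1) / (sqrt pi * (2 * \<alpha>) powr m * Gamma (m + 1/2))"

lemma vg_formula_eq: "vg_formula m \<alpha> \<beta> x = vg_const m \<alpha> \<beta> * (exp (\<beta> * x) * \<bar>x\<bar> powr m * bessel_K m (\<alpha> * \<bar>x\<bar>))"
  by (simp add: vg_formula_def vg_const_def mult.assoc)

lemma vg_density_eq: "x \<noteq> 0 \<Longrightarrow> vg_density m \<alpha> \<beta> x = vg_const m \<alpha> \<beta> * (exp (\<beta> * x) * \<bar>x\<bar> powr m * bessel_K m (\<alpha> * \<bar>x\<bar>))"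
  by (simp add: vg_density_def vg_formula_eq)

lemma vg_density_measurable [measurable]: "vg_density m \<alpha> \<beta> \<in> borel_measurable borel"
  unfolding vg_density_def vg_formula_eq by measurable

lemma vg_gamma_pos: "\<bar>\<beta>\<bar> < \<alpha> \<Longrightarrow> vg_gamma \<alpha> \<beta> > 0"
  using power_strict_mono[of "\<bar>\<beta>\<bar>" \<alpha> 2] by (simp add: vg_gamma_def)

lemma vg_const_pos:
  assumes "m > - 1/2" "\<bar>\<beta>\<bar> < \<alpha>"
  shows "vg_const m \<alpha> \<beta> > 0"
  using assms vg_gamma_pos[OF assms(2)] by (auto simp: vg_const_def Gamma_real_pos)

lemma tendsto_powr_mult_bessel_K_abs:
  fixes \<mu> k :: real
  assumes "\<mu> > 0" "k > 0"
  shows "((\<lambda>x. (k * \<bar>x\<bar>) powr \<mu> * bessel_K \<mu> (k * \<bar>x\<bar>)) \<longlongrightarrow> 2 powr (\<mu> - 1) * Gamma \<mu>) (at 0)"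
proof -
  have "filterlim (\<lambda>x. k * \<bar>x\<bar>) (at_right 0) (at 0)"
    using assms unfolding filterlim_at
    by (auto intro!: tendsto_eq_intros simp: eventually_at_filter)
  from filterlim_compose[OF tendsto_powr_mult_bessel_K[OF assms(1)] this] show ?thesis .
qed

lemma tendsto_vg_formula:
  assumes "m > 0" "\<alpha> > 0"
  shows "(vg_formula m \<alpha> \<beta> \<longlongrightarrow> vg_const m \<alpha> \<beta> * \<alpha> powr - m * (2 powr (m - 1) * Gamma m)) (at 0)"
proof -
  have "((\<lambda>x. vg_const m \<alpha> \<beta> * \<alpha> powr - m * exp (\<beta> * x) * ((\<alpha> * \<bar>x\<bar>) powr m * bessel_K m (\<alpha> * \<bar>x\<bar>)))
      \<longlongrightarrow> vg_const m \<alpha> \<beta> * \<alpha> powr - m * exp (\<beta> * 0) * (2 powr (m - 1) * Gamma m)) (at 0)"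
    by (intro tendsto_intros tendsto_powr_mult_bessel_K_abs assms)
  moreover have "vg_const m \<alpha> \<beta> * \<alpha> powr - m * exp (\<beta> * x) * ((\<alpha> * \<bar>x\<bar>) powr m * bessel_K m (\<alpha> * \<bar>x\<bar>)) = vg_formula m \<alpha> \<beta> x" for x
    using assms by (simp add: vg_formula_eq powr_mult powr_minus field_simps)
  ultimately show ?thesis by simp
qed

text \<open>The value is defined through \<open>Lim\<close>, so it is pinned down by exhibiting a
  limit and invoking uniqueness.\<close>

lemma vg_density_0:
  assumes "m > 0" "\<alpha> > 0"
  shows "vg_density m \<alpha> \<beta> 0 = vg_const m \<alpha> \<beta> * \<alpha> powr - m * (2 powr (m - 1) * Gamma m)"
  using tendsto_Lim[OF _ tendsto_vg_formula[OF assms]] assms by (simp add: vg_density_def)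

lemma vg_density_nonneg:
  assumes "m > - 1/2" "\<bar>\<beta>\<bar> < \<alpha>"
  shows "vg_density m \<alpha> \<beta> x \<ge> 0"
proof -
  have "\<alpha> > 0" using assms by linarith
  then show ?thesis
    using vg_const_pos[OF assms]
    by (cases "x = 0"; cases "m > 0")
      (auto simp: vg_density_eq vg_density_0 Gamma_real_pos less_imp_le, simp add: vg_density_def)
qed

text \<open>The factor \<open>exp (b * y)\<close> merges with \<open>exp (\<beta> * y)\<close>,
  hence the condition on \<open>\<beta> + b\<close>. The value \<open>b = 0\<close> gives the
  constants of the asymptotics, nonzero \<open>b\<close> the integrability of the majorants.\<close>

lemma vg_density_moment:
  fixes a n \<alpha> \<beta> b :: real
  assumes "a > 0" "a + n > 0" "n > - 1/2" "\<bar>\<beta>\<bar> < \<alpha>" "\<bar>\<beta> + b\<bar> < \<alpha>"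
  shows "has_bochner_integral lborel (\<lambda>y. \<bar>y\<bar> powr (2 * a - 1) * exp (b * y) * vg_density n \<alpha> \<beta> y)
    (vg_const n \<alpha> \<beta> * (2 powr (2 * a + n - 1) * \<alpha> powr - (2 * a + n) * (Gamma a * Gamma (a + n)) *
      hyp2F1 a (a + n) (1/2) ((\<beta> + b)\<^sup>2 / \<alpha>\<^sup>2)))"
    (is "has_bochner_integral _ _ (?C * ?I)")
proof (rule has_bochner_integral_nn_integral)
  have C: "?C > 0" using assms by (intro vg_const_pos)
  have "\<alpha> > 0" using assms by linarith
  have "(\<beta> + b)\<^sup>2 / \<alpha>\<^sup>2 < 1"
    using assms \<open>\<alpha> > 0\<close> by (simp add: abs_square_less_1 flip: power_divide)
  then have I: "?I \<ge> 0"
    using assms by (intro mult_nonneg_nonneg less_imp_le[OF hyp2F1_pos] less_imp_le[OF Gamma_real_pos]) auto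
  show "AE y in lborel. 0 \<le> \<bar>y\<bar> powr (2 * a - 1) * exp (b * y) * vg_density n \<alpha> \<beta> y"
    using assms by (intro AE_I2 mult_nonneg_nonneg vg_density_nonneg) auto
  show "0 \<le> ?C * ?I" using C I by auto
  have "(\<integral>\<^sup>+y. ennreal (\<bar>y\<bar> powr (2 * a - 1) * exp (b * y) * vg_density n \<alpha> \<beta> y) \<partial>lborel) =
      (\<integral>\<^sup>+y. ennreal ?C * ennreal (\<bar>y\<bar> powr (2 * a + n - 1) * exp ((\<beta> + b) * y) * bessel_K n (\<alpha> * \<bar>y\<bar>)) \<partial>lborel)"
  proof (rule nn_integral_cong_AE, use AE_lborel_singleton[of "0::real"] in eventually_elim)
    fix y :: real assume "y \<noteq> 0"
    have "\<bar>y\<bar> powr (2 * a + n - 1) = \<bar>y\<bar> powr (2 * a - 1) * \<bar>y\<bar> powr n"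
      using \<open>y \<noteq> 0\<close> by (simp add: powr_add [symmetric] algebra_simps)
    moreover have "exp ((\<beta> + b) * y) = exp (\<beta> * y) * exp (b * y)"
      by (simp add: exp_add distrib_right)
    ultimately have "\<bar>y\<bar> powr (2 * a - 1) * exp (b * y) * vg_density n \<alpha> \<beta> y =
        ?C * (\<bar>y\<bar> powr (2 * a + n - 1) * exp ((\<beta> + b) * y) * bessel_K n (\<alpha> * \<bar>y\<bar>))"
      unfolding vg_density_eq[OF \<open>y \<noteq> 0\<close>] by (simp only: mult_ac)
    then show "ennreal (\<bar>y\<bar> powr (2 * a - 1) * exp (b * y) * vg_density n \<alpha> \<beta> y) =
      ennreal ?C * ennreal (\<bar>y\<bar> powr (2 * a + n - 1) * exp ((\<beta> + b) * y) * bessel_K n (\<alpha> * \<bar>y\<bar>))"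
      using C by (simp add: ennreal_mult')
  qed
  also have "\<dots> = ennreal ?C * ennreal ?I"
    by (subst nn_integral_cmult) (use assms in \<open>auto simp: nn_integral_abs_powr_exp_bessel_K\<close>)
  finally show "(\<integral>\<^sup>+y. ennreal (\<bar>y\<bar> powr (2 * a - 1) * exp (b * y) * vg_density n \<alpha> \<beta> y) \<partial>lborel) = ennreal (?C * ?I)"
    using C by (simp add: ennreal_mult')
qed measurable

lemma vg_density_abs_moment:
  assumes "a > 0" "a + n > 0" "n > - 1/2" "\<bar>\<beta>\<bar> < \<alpha>"
  shows "(LBINT y. \<bar>y\<bar> powr (2 * a - 1) * vg_density n \<alpha> \<beta> y) =
    vg_const n \<alpha> \<beta> * (2 powr (2 * a + n - 1) * \<alpha> powr - (2 * a + n) * (Gamma a * Gamma (a + n)) *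
      hyp2F1 a (a + n) (1/2) (\<beta>\<^sup>2 / \<alpha>\<^sup>2))"
  using vg_density_moment[of a n \<beta> \<alpha> 0] assms by (simp add: has_bochner_integral_iff)

lemma integrable_vg_density_two_sided_exp:
  fixes a n \<alpha> \<beta> \<epsilon> :: real
  assumes "a > 0" "a + n > 0" "n > - 1/2" "\<epsilon> > 0" "\<bar>\<beta>\<bar> + \<epsilon> < \<alpha>"
  shows "integrable lborel (\<lambda>y. \<bar>y\<bar> powr (2 * a - 1) * (exp (\<epsilon> * y) + exp (- \<epsilon> * y)) * vg_density n \<alpha> \<beta> y)"
proof -
  have "integrable lborel (\<lambda>y. \<bar>y\<bar> powr (2 * a - 1) * exp (\<epsilon> * y) * vg_density n \<alpha> \<beta> y
      + \<bar>y\<bar> powr (2 * a - 1) * exp (- \<epsilon> * y) * vg_density n \<alpha> \<beta> y)"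
    using assms
    by (intro Bochner_Integration.integrable_add integrable.intros[OF vg_density_moment]) linarith+
  then show ?thesis by (simp add: algebra_simps)
qed

section \<open>Behaviour of the ratio density at the origin\<close>

lemma ratio_density_vg_at_0:
  assumes "m > 0" "\<alpha>1 > 0"
  shows "ratio_density (vg_density m \<alpha>1 \<beta>1) (vg_density n \<alpha>2 \<beta>2) 0 =
     vg_const m \<alpha>1 \<beta>1 * \<alpha>1 powr - m * (2 powr (m - 1) * Gamma m) *
     (LBINT y. \<bar>y\<bar> powr (2 * 1 - 1) * vg_density n \<alpha>2 \<beta>2 y)"
proof -
  have "ratio_density (vg_density m \<alpha>1 \<beta>1) (vg_density n \<alpha>2 \<beta>2) 0 =
     (LBINT y. vg_density m \<alpha>1 \<beta>1 0 * (\<bar>y\<bar> powr (2 * 1 - 1) * vg_density n \<alpha>2 \<beta>2 y))"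
    unfolding ratio_density_def by (intro Bochner_Integration.integral_cong) auto
  then show ?thesis by (simp add: vg_density_0 assms)
qed

text \<open>The sum of two exponentials is used rather than
  \<open>exp (\<epsilon> * \<bar>y\<bar>)\<close> because each summand is covered by the moment
  formula. Adding 1 to \<open>\<bar>\<beta>\<bar>\<close> avoids a division by zero when
  \<open>\<beta> = 0\<close>.\<close>

lemma exp_le_two_sided:
  fixes \<beta> y z \<epsilon> :: real
  assumes "\<bar>z\<bar> < \<epsilon> / (\<bar>\<beta>\<bar> + 1)" "\<epsilon> > 0"
  shows "exp (\<beta> * (y * z)) \<le> exp (\<epsilon> * y) + exp (- \<epsilon> * y)"
proof -
  have "\<bar>\<beta>\<bar> * \<bar>z\<bar> \<le> (\<bar>\<beta>\<bar> + 1) * \<bar>z\<bar>" by (simp add: distrib_right)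
  also have "\<dots> \<le> \<epsilon>" using assms(1) by (simp add: field_simps add_pos_nonneg)
  finally have "\<bar>\<beta>\<bar> * \<bar>z\<bar> * \<bar>y\<bar> \<le> \<epsilon> * \<bar>y\<bar>" by (rule mult_right_mono) simp
  moreover have "\<beta> * (y * z) \<le> \<bar>\<beta>\<bar> * \<bar>z\<bar> * \<bar>y\<bar>"
    using abs_ge_self[of "\<beta> * (y * z)"] by (simp add: abs_mult mult_ac)
  ultimately have "exp (\<beta> * (y * z)) \<le> exp (\<epsilon> * \<bar>y\<bar>)" by simp
  also have "\<dots> \<le> exp (\<epsilon> * y) + exp (- \<epsilon> * y)" by (auto simp: abs_if)
  finally show ?thesis .
qed

lemma ratio_density_vg_neg:
  fixes m n \<alpha>1 \<alpha>2 \<beta>1 \<beta>2 :: real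
  assumes m: "- 1/2 < m" "m < 0" and n: "n > - 1/2" and \<beta>1: "\<bar>\<beta>1\<bar> < \<alpha>1" and \<beta>2: "\<bar>\<beta>2\<bar> < \<alpha>2"
  shows "((\<lambda>z. ratio_density (vg_density m \<alpha>1 \<beta>1) (vg_density n \<alpha>2 \<beta>2) z / \<bar>z\<bar> powr (2 * m)) \<longlongrightarrow>
     vg_const m \<alpha>1 \<beta>1 * \<alpha>1 powr m * (2 powr (- m - 1) * Gamma (- m)) *
     (LBINT y. \<bar>y\<bar> powr (2 * m + 1) * vg_density n \<alpha>2 \<beta>2 y)) (at 0)"
proof -
  \<comment> \<open>Half the gap, so that \<open>\<beta>2 + \<epsilon>\<close> and
    \<open>\<beta>2 - \<epsilon>\<close> still have modulus below \<open>\<alpha>2\<close>.\<close>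
  define \<epsilon> where "\<epsilon> = (\<alpha>2 - \<bar>\<beta>2\<bar>) / 2"
  have \<epsilon>: "\<epsilon> > 0" "\<bar>\<beta>2\<bar> + \<epsilon> < \<alpha>2" using \<beta>2 by (auto simp: \<epsilon>_def field_simps)
  have \<alpha>1: "\<alpha>1 > 0" using \<beta>1 by linarith
  define C where "C = vg_const m \<alpha>1 \<beta>1 * \<alpha>1 powr m"
  have C: "C > 0" using vg_const_pos[OF m(1) \<beta>1] \<alpha>1 by (simp add: C_def)
  \<comment> \<open>\<open>H\<close> is the regular part of the Bessel function: bounded by
    \<open>B\<close> on the positive axis and tending to \<open>B\<close> at 0.\<close>
  define H where "H x = x powr - m * bessel_K (- m) x" for x
  define B where "B = 2 powr (- m - 1) * Gamma (- m)"
  have HB: "0 \<le> H x" "H x \<le> B" if "x > 0" for x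
    using that m powr_mult_bessel_K_le[of "- m" x] by (auto simp: H_def B_def)
  have eq: "vg_density m \<alpha>1 \<beta>1 (y * z) / \<bar>z\<bar> powr (2 * m) =
      C * \<bar>y\<bar> powr (2 * m) * exp (\<beta>1 * (y * z)) * H (\<alpha>1 * \<bar>y\<bar> * \<bar>z\<bar>)" if "y \<noteq> 0" "z \<noteq> 0" for y z
  proof -
    have sq: "t powr (2 * m) = t powr m * t powr m" for t :: real
      by (simp only: mult_2 powr_add)
    have pow: "\<alpha>1 powr m * \<bar>y\<bar> powr (2 * m) * \<bar>z\<bar> powr (2 * m) * (\<alpha>1 * \<bar>y\<bar> * \<bar>z\<bar>) powr - m = \<bar>y * z\<bar> powr m"
      unfolding sq using that \<alpha>1 by (simp add: powr_mult powr_minus abs_mult field_simps)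
    have dens: "vg_density m \<alpha>1 \<beta>1 (y * z) = vg_const m \<alpha>1 \<beta>1 * (exp (\<beta>1 * (y * z)) * \<bar>y * z\<bar> powr m * bessel_K (- m) (\<alpha>1 * \<bar>y\<bar> * \<bar>z\<bar>))"
      using that by (simp add: vg_density_eq bessel_K_uminus abs_mult mult.assoc)
    have "vg_density m \<alpha>1 \<beta>1 (y * z) =
       C * \<bar>y\<bar> powr (2 * m) * exp (\<beta>1 * (y * z)) * H (\<alpha>1 * \<bar>y\<bar> * \<bar>z\<bar>) * \<bar>z\<bar> powr (2 * m)"
      unfolding dens pow [symmetric] C_def H_def by (simp only: mult_ac)
    then show ?thesis using that by simp
  qed
  define D where "D y = C * B * (\<bar>y\<bar> powr (2 * m) * (exp (\<epsilon> * y) + exp (- \<epsilon> * y)))" for y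
  have "((\<lambda>z. ratio_density (vg_density m \<alpha>1 \<beta>1) (vg_density n \<alpha>2 \<beta>2) z / \<bar>z\<bar> powr (2 * m)) \<longlongrightarrow>
      C * B * (LBINT y. \<bar>y\<bar> powr (2 * m + 1) * vg_density n \<alpha>2 \<beta>2 y)) (at 0)"
  proof (rule tendsto_ratio_density[where D = D])
    show "\<epsilon> / (\<bar>\<beta>1\<bar> + 1) > 0" using \<epsilon> by (simp add: add_nonneg_pos)
    fix y :: real assume y: "y \<noteq> 0"
    have "((\<lambda>z. C * \<bar>y\<bar> powr (2 * m) * exp (\<beta>1 * (y * z)) * H (\<alpha>1 * \<bar>y\<bar> * \<bar>z\<bar>)) \<longlongrightarrow>
        C * \<bar>y\<bar> powr (2 * m) * exp (\<beta>1 * (y * 0)) * B) (at 0)"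
      unfolding H_def B_def using m \<alpha>1 y
      by (intro tendsto_intros tendsto_powr_mult_bessel_K_abs) auto
    then have "((\<lambda>z. C * \<bar>y\<bar> powr (2 * m) * exp (\<beta>1 * (y * z)) * H (\<alpha>1 * \<bar>y\<bar> * \<bar>z\<bar>)) \<longlongrightarrow>
        C * B * \<bar>y\<bar> powr (2 * m)) (at 0)"
      by (simp add: mult_ac)
    then show "((\<lambda>z. vg_density m \<alpha>1 \<beta>1 (y * z) / \<bar>z\<bar> powr (2 * m)) \<longlongrightarrow> C * B * \<bar>y\<bar> powr (2 * m)) (at 0)"
      by (rule Lim_transform_eventually) (use eq[OF y] in \<open>auto simp: eventually_at_filter\<close>)
  next
    fix y z :: real assume yz: "y \<noteq> 0" "z \<noteq> 0" and z: "\<bar>z\<bar> < \<epsilon> / (\<bar>\<beta>1\<bar> + 1)"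
    have h: "0 \<le> H (\<alpha>1 * \<bar>y\<bar> * \<bar>z\<bar>)" "H (\<alpha>1 * \<bar>y\<bar> * \<bar>z\<bar>) \<le> B" using HB yz \<alpha>1 by auto
    have "exp (\<beta>1 * (y * z)) * H (\<alpha>1 * \<bar>y\<bar> * \<bar>z\<bar>) \<le> (exp (\<epsilon> * y) + exp (- \<epsilon> * y)) * B"
      by (intro mult_mono exp_le_two_sided[OF z] h \<epsilon> add_nonneg_nonneg) auto
    then have "C * \<bar>y\<bar> powr (2 * m) * (exp (\<beta>1 * (y * z)) * H (\<alpha>1 * \<bar>y\<bar> * \<bar>z\<bar>)) \<le>
        C * \<bar>y\<bar> powr (2 * m) * ((exp (\<epsilon> * y) + exp (- \<epsilon> * y)) * B)"
      using C by (intro mult_left_mono) auto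
    then show "\<bar>vg_density m \<alpha>1 \<beta>1 (y * z) / \<bar>z\<bar> powr (2 * m)\<bar> \<le> D y"
      unfolding eq[OF yz] using C h by (simp add: D_def abs_mult mult_ac)
  next
    \<comment> \<open>With the extra factor \<open>\<bar>y\<bar>\<close> the power is
      \<open>2 * m + 1\<close>, that is \<open>a = m + 1\<close>; then \<open>a + n > 0\<close>
      since \<open>m\<close> and \<open>n\<close> both exceed \<open>- 1/2\<close>.\<close>
    have "integrable lborel (\<lambda>y. C * B * (\<bar>y\<bar> powr (2 * (m + 1) - 1) * (exp (\<epsilon> * y) + exp (- \<epsilon> * y)) * vg_density n \<alpha>2 \<beta>2 y))"
      using m n \<epsilon> by (intro integrable_mult_right integrable_vg_density_two_sided_exp) auto
    moreover have "C * B * (\<bar>y\<bar> powr (2 * (m + 1) - 1) * (exp (\<epsilon> * y) + exp (- \<epsilon> * y)) * vg_density n \<alpha>2 \<beta>2 y) =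
       \<bar>y\<bar> * D y * \<bar>vg_density n \<alpha>2 \<beta>2 y\<bar>" for y
    proof (cases "y = 0")
      case False
      then have "\<bar>y\<bar> powr (2 * (m + 1) - 1) = \<bar>y\<bar> * \<bar>y\<bar> powr (2 * m)"
        by (simp add: powr_add [symmetric] powr_mult_base algebra_simps)
      then show ?thesis using vg_density_nonneg[OF n \<beta>2] by (simp add: D_def mult_ac)
    qed auto
    ultimately show "integrable lborel (\<lambda>y. \<bar>y\<bar> * D y * \<bar>vg_density n \<alpha>2 \<beta>2 y\<bar>)" by (simp only:)
  qed measurable
  then show ?thesis by (simp add: C_def B_def mult.assoc)
qed

lemma ratio_density_vg_zero:
  fixes n \<alpha>1 \<alpha>2 \<beta>1 \<beta>2 :: real
  assumes n: "n > - 1/2" and \<beta>1: "\<bar>\<beta>1\<bar> < \<alpha>1" and \<beta>2: "\<bar>\<beta>2\<bar> < \<alpha>2"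
  shows "((\<lambda>z. ratio_density (vg_density 0 \<alpha>1 \<beta>1) (vg_density n \<alpha>2 \<beta>2) z / - ln \<bar>z\<bar>) \<longlongrightarrow>
     vg_const 0 \<alpha>1 \<beta>1 * (LBINT y. \<bar>y\<bar> powr (0 + 1) * vg_density n \<alpha>2 \<beta>2 y)) (at 0)"
proof -
  define \<epsilon> where "\<epsilon> = (\<alpha>2 - \<bar>\<beta>2\<bar>) / 2"
  have \<epsilon>: "\<epsilon> > 0" "\<bar>\<beta>2\<bar> + \<epsilon> < \<alpha>2" using \<beta>2 by (auto simp: \<epsilon>_def field_simps)
  have \<alpha>1: "\<alpha>1 > 0" using \<beta>1 by linarith
  define C where "C = vg_const 0 \<alpha>1 \<beta>1"
  have C: "C > 0" using vg_const_pos[of 0, OF _ \<beta>1] by (simp add: C_def)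
  have eq: "vg_density 0 \<alpha>1 \<beta>1 (y * z) / - ln \<bar>z\<bar> =
      C * exp (\<beta>1 * (y * z)) * (bessel_K 0 (\<alpha>1 * \<bar>y\<bar> * \<bar>z\<bar>) / - ln \<bar>z\<bar>)" if "y \<noteq> 0" "z \<noteq> 0" for y z
    using that by (simp add: vg_density_eq C_def abs_mult mult.assoc)
  define E where "E y = exp (\<epsilon> * y) + exp (- \<epsilon> * y)" for y
  have E: "E y \<ge> 0" for y by (simp add: E_def)
  \<comment> \<open>With \<open>k = \<alpha>1 * \<bar>y\<bar>\<close>, the bracket
    \<open>3 + k + 1 / k\<close> bounds the Bessel function at \<open>k * \<bar>z\<bar>\<close>
    divided by \<open>- ln \<bar>z\<bar>\<close>. Its pole at \<open>y = 0\<close> is removed by the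
    weight \<open>\<bar>y\<bar>\<close> of the ratio density.\<close>
  define D where "D y = C * (E y * (3 + \<alpha>1 * \<bar>y\<bar> + 1 / (\<alpha>1 * \<bar>y\<bar>)))" for y
  have ln_lim: "filterlim (\<lambda>z::real. ln \<bar>z\<bar>) at_bot (at 0)"
  proof -
    have "filterlim (\<lambda>z::real. \<bar>z\<bar>) (at_right 0) (at 0)"
      unfolding filterlim_at by (auto intro!: tendsto_eq_intros simp: eventually_at_filter)
    from filterlim_compose[OF ln_at_0 this] show ?thesis .
  qed
  \<comment> \<open>The bound \<open>exp (- 1)\<close> ensures
    \<open>- ln \<bar>z\<bar> \<ge> 1\<close>, so that constants can be absorbed into the logarithm;
    the other one serves the exponential factor.\<close>
  define \<delta> where "\<delta> = min (exp (- 1)) (\<epsilon> / (\<bar>\<beta>1\<bar> + 1))"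
  have "((\<lambda>z. ratio_density (vg_density 0 \<alpha>1 \<beta>1) (vg_density n \<alpha>2 \<beta>2) z / - ln \<bar>z\<bar>) \<longlongrightarrow>
      C * (LBINT y. \<bar>y\<bar> powr (0 + 1) * vg_density n \<alpha>2 \<beta>2 y)) (at 0)"
  proof (rule tendsto_ratio_density[where D = D])
    show "\<delta> > 0" using \<epsilon> by (simp add: \<delta>_def add_nonneg_pos)
    fix y :: real assume y: "y \<noteq> 0"
    define k where "k = \<alpha>1 * \<bar>y\<bar>"
    have k: "k > 0" using \<alpha>1 y by (simp add: k_def)
    have "filterlim (\<lambda>z. k * \<bar>z\<bar>) (at_right 0) (at 0)"
      unfolding filterlim_at using k by (auto intro!: tendsto_eq_intros simp: eventually_at_filter)
    from filterlim_compose[OF tendsto_bessel_K_0_div_ln this]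
    have K: "((\<lambda>z. bessel_K 0 (k * \<bar>z\<bar>) / - ln (k * \<bar>z\<bar>)) \<longlongrightarrow> 1) (at 0)" .
    \<comment> \<open>This is the limit of \<open>ln (k * \<bar>z\<bar>) / ln \<bar>z\<bar>\<close>:
      the scaling by \<open>k\<close> is invisible to leading logarithmic order.\<close>
    have "((\<lambda>z. ln k / ln \<bar>z\<bar> + 1) \<longlongrightarrow> 0 + 1) (at 0)"
      by (intro tendsto_add tendsto_const tendsto_divide_0[OF tendsto_const]
          filterlim_at_bot_imp_at_infinity ln_lim)
    from tendsto_mult[OF tendsto_mult[OF tendsto_mult[OF tendsto_const[of C] tendsto_exp[OF
          tendsto_mult[OF tendsto_const[of \<beta>1] tendsto_mult[OF tendsto_const[of y] tendsto_ident_at]]]] K] this]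
    have lim: "((\<lambda>z. C * exp (\<beta>1 * (y * z)) * (bessel_K 0 (k * \<bar>z\<bar>) / - ln (k * \<bar>z\<bar>)) * (ln k / ln \<bar>z\<bar> + 1))
        \<longlongrightarrow> C * \<bar>y\<bar> powr 0) (at 0)"
      using y by simp
    have "\<forall>\<^sub>F z::real in at 0. z \<noteq> 0" by (simp add: eventually_at_filter)
    moreover have "\<forall>\<^sub>F z::real in at 0. ln \<bar>z\<bar> < min 0 (- ln k)"
      using ln_lim unfolding filterlim_at_bot_dense by blast
    ultimately have "\<forall>\<^sub>F z in at 0. C * exp (\<beta>1 * (y * z)) * (bessel_K 0 (k * \<bar>z\<bar>) / - ln (k * \<bar>z\<bar>)) * (ln k / ln \<bar>z\<bar> + 1)
        = vg_density 0 \<alpha>1 \<beta>1 (y * z) / - ln \<bar>z\<bar>"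
    proof eventually_elim
      case (elim z)
      have l: "ln (k * \<bar>z\<bar>) = ln k + ln \<bar>z\<bar>" using elim k by (simp add: ln_mult)
      have "ln \<bar>z\<bar> \<noteq> 0" "ln k + ln \<bar>z\<bar> \<noteq> 0" using elim by auto
      then have "bessel_K 0 (k * \<bar>z\<bar>) / - ln (k * \<bar>z\<bar>) * (ln k / ln \<bar>z\<bar> + 1) = bessel_K 0 (k * \<bar>z\<bar>) / - ln \<bar>z\<bar>"
        unfolding l by (simp add: divide_simps) (simp add: algebra_simps)
      then show ?case unfolding eq[OF y elim(1)] k_def [symmetric] by (simp only: mult.assoc)
    qed
    with lim show "((\<lambda>z. vg_density 0 \<alpha>1 \<beta>1 (y * z) / - ln \<bar>z\<bar>) \<longlongrightarrow> C * \<bar>y\<bar> powr 0) (at 0)"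
      by (rule Lim_transform_eventually)
  next
    fix y z :: real assume yz: "y \<noteq> 0" "z \<noteq> 0" and z: "\<bar>z\<bar> < \<delta>"
    define k L where "k = \<alpha>1 * \<bar>y\<bar>" and "L = - ln \<bar>z\<bar>"
    have k: "k > 0" using \<alpha>1 yz by (simp add: k_def)
    have "ln \<bar>z\<bar> < ln (exp (- 1))" using z yz by (subst ln_less_cancel_iff) (auto simp: \<delta>_def)
    then have L: "L \<ge> 1" by (simp add: L_def)
    have "ln k \<le> k" using ln_le_minus_one[OF k] by simp
    moreover have "- ln k \<le> 1 / k"
      using ln_le_minus_one[of "1 / k"] k by (simp add: ln_div)
    ultimately have "max 0 (- ln k) \<le> k + 1 / k" using k by (auto simp: add_increasing)
    moreover have "bessel_K 0 (k * \<bar>z\<bar>) \<le> 2 + max 0 (- ln k + L)"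
      using bessel_K_0_le[of "k * \<bar>z\<bar>"] k yz by (simp add: ln_mult L_def)
    ultimately have "bessel_K 0 (k * \<bar>z\<bar>) \<le> 2 + L + (k + 1 / k)" using L by linarith
    \<comment> \<open>Each summand is enlarged to a multiple of \<open>L\<close>, using
      \<open>L \<ge> 1\<close>; the 3 is \<open>2 + 1\<close>.\<close>
    also have "\<dots> \<le> 2 * L + L + (k + 1 / k) * L"
      using L k mult_left_mono[of 1 L "k + 1 / k"] by simp
    also have "\<dots> = (3 + k + 1 / k) * L" by (simp add: algebra_simps)
    finally have b: "bessel_K 0 (k * \<bar>z\<bar>) / L \<le> 3 + k + 1 / k"
      using L by (simp add: pos_divide_le_eq)
    have "exp (\<beta>1 * (y * z)) * (bessel_K 0 (k * \<bar>z\<bar>) / L) \<le> E y * (3 + k + 1 / k)"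
      unfolding E_def using z L
      by (intro mult_mono exp_le_two_sided b \<epsilon> add_nonneg_nonneg) (auto simp: \<delta>_def)
    then have "C * (exp (\<beta>1 * (y * z)) * (bessel_K 0 (k * \<bar>z\<bar>) / L)) \<le> D y"
      using C unfolding D_def k_def [symmetric] by (intro mult_left_mono) auto
    moreover have "\<bar>vg_density 0 \<alpha>1 \<beta>1 (y * z) / - ln \<bar>z\<bar>\<bar> = C * (exp (\<beta>1 * (y * z)) * (bessel_K 0 (k * \<bar>z\<bar>) / L))"
      unfolding eq[OF yz] using C L by (simp add: abs_mult k_def L_def)
    ultimately show "\<bar>vg_density 0 \<alpha>1 \<beta>1 (y * z) / - ln \<bar>z\<bar>\<bar> \<le> D y"
      by (simp only:)
  next
    let ?I = "\<lambda>a y. \<bar>y\<bar> powr (2 * a - 1) * (exp (\<epsilon> * y) + exp (- \<epsilon> * y)) * vg_density n \<alpha>2 \<beta>2 y"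
    \<comment> \<open>After multiplication by \<open>\<bar>y\<bar>\<close> the three terms of
      \<open>D\<close> carry the powers 1, 2 and 0 of \<open>\<bar>y\<bar>\<close>, that is
      \<open>a = 1\<close>, \<open>3/2\<close> and \<open>1/2\<close>. For the last one
      \<open>a + n > 0\<close> is exactly the hypothesis \<open>n > - 1/2\<close>.\<close>
    have int: "integrable lborel (\<lambda>y. C * (3 * ?I 1 y + \<alpha>1 * ?I (3/2) y + 1 / \<alpha>1 * ?I (1/2) y))"
      using n \<epsilon> by (intro integrable_mult_right Bochner_Integration.integrable_add integrable_vg_density_two_sided_exp) auto
    show "integrable lborel (\<lambda>y. \<bar>y\<bar> * D y * \<bar>vg_density n \<alpha>2 \<beta>2 y\<bar>)"
    proof (rule integrable_cong_AE_imp[OF int])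
      show "AE y in lborel. C * (3 * ?I 1 y + \<alpha>1 * ?I (3/2) y + 1 / \<alpha>1 * ?I (1/2) y) = \<bar>y\<bar> * D y * \<bar>vg_density n \<alpha>2 \<beta>2 y\<bar>"
        using AE_lborel_singleton[of "0::real"]
      proof eventually_elim
        case (elim y)
        have "?I 1 y = \<bar>y\<bar> * E y * vg_density n \<alpha>2 \<beta>2 y" "?I (3/2) y = \<bar>y\<bar> ^ 2 * E y * vg_density n \<alpha>2 \<beta>2 y"
          "?I (1/2) y = E y * vg_density n \<alpha>2 \<beta>2 y"
          using elim by (simp_all add: E_def powr_numeral)
        then show ?case
          using vg_density_nonneg[OF n \<beta>2, of y] elim \<alpha>1
          by (simp only: D_def abs_of_nonneg) (simp add: field_simps power2_eq_square)
      qed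
    qed (unfold D_def E_def, measurable)
  qed measurable
  then show ?thesis by (simp add: C_def)
qed

section \<open>The constants of the three cases\<close>

text \<open>Integers need no exclusion: there one Gamma factor is at a pole and equals 0 by
  convention, and the right side is a division by zero.\<close>

lemma Gamma_reflection_real:
  fixes x :: real
  shows "Gamma x * Gamma (1 - x) = pi / sin (pi * x)"
proof -
  have "complex_of_real (Gamma x * Gamma (1 - x)) = Gamma (of_real x) * Gamma (1 - of_real x)"
    by (simp flip: Gamma_complex_of_real)
  also have "\<dots> = complex_of_real (pi / sin (pi * x))"
    by (simp add: Gamma_reflection_complex flip: sin_of_real)
  finally show ?thesis by (simp only: of_real_eq_iff)
qed

text \<open>A density is determined only almost everywhere, so values and limits at 0 refer to a
  chosen version; the first conjunct certifies that this version is a density of the ratio.\<close>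

theorem proposition2p7:
  fixes M :: "'a measure" and X Y :: "'a \<Rightarrow> real"
    and m n \<alpha>1 \<beta>1 \<alpha>2 \<beta>2 \<gamma>1 \<gamma>2 :: real and f_Z :: "real \<Rightarrow> real"
  assumes "prob_space M"
    and "m > -1/2" and "n > -1/2"
    and "0 \<le> \<bar>\<beta>1\<bar>" and "\<bar>\<beta>1\<bar> < \<alpha>1" and "0 \<le> \<bar>\<beta>2\<bar>" and "\<bar>\<beta>2\<bar> < \<alpha>2"
    and "vg_distributed M X m \<alpha>1 \<beta>1" and "vg_distributed M Y n \<alpha>2 \<beta>2"
    and "prob_space.indep_var M borel X borel Y"
    and "\<gamma>1 = vg_gamma \<alpha>1 \<beta>1" and "\<gamma>2 = vg_gamma \<alpha>2 \<beta>2"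
    and "f_Z = ratio_density (vg_density m \<alpha>1 \<beta>1) (vg_density n \<alpha>2 \<beta>2)"
  shows "distributed M lborel (\<lambda>\<omega>. X \<omega> / Y \<omega>) (\<lambda>z. ennreal (f_Z z)) \<and>
    (m > 0 \<longrightarrow>
      f_Z 0 = \<gamma>1 powr (2 * m + 1) * \<gamma>2 powr (2 * n + 1)
                / (pi * \<alpha>1 powr (2 * m) * \<alpha>2 powr (2 * n + 2))
              * (Gamma m * Gamma (n + 1) / (Gamma (m + 1/2) * Gamma (n + 1/2)))
              * hyp2F1 1 (n + 1) (1/2) (\<beta>2\<^sup>2 / \<alpha>2\<^sup>2)) \<and>
    (m = 0 \<longrightarrow>
      f_Z \<sim>[at 0] (\<lambda>z. - (2 * \<gamma>1 * \<gamma>2 powr (2 * n + 1)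
                / (pi powr (3/2) * \<alpha>2 powr (2 * n + 2)))
              * (Gamma (n + 1) * ln \<bar>z\<bar> / Gamma (n + 1/2))
              * hyp2F1 1 (n + 1) (1/2) (\<beta>2\<^sup>2 / \<alpha>2\<^sup>2))) \<and>
    (m < 0 \<longrightarrow>
      f_Z \<sim>[at 0] (\<lambda>z. \<gamma>1 powr (2 * m + 1) * \<gamma>2 powr (2 * n + 1)
                / (\<alpha>2 powr (2 * m + 2 * n + 2) * sin (- m * pi))
              * (Gamma (m + n + 1) * \<bar>z\<bar> powr (2 * m) / (Gamma (m + 1/2) * Gamma (n + 1/2)))
              * hyp2F1 (m + 1) (m + n + 1) (1/2) (\<beta>2\<^sup>2 / \<alpha>2\<^sup>2)))"
proof (intro conjI impI)
  note m = assms(2) and n = assms(3) and \<beta>1 = assms(5) and \<beta>2 = assms(7)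
  have \<alpha>: "\<alpha>1 > 0" "\<alpha>2 > 0" using \<beta>1 \<beta>2 by linarith+
  have \<gamma>: "\<gamma>1 > 0" "\<gamma>2 > 0" using vg_gamma_pos \<beta>1 \<beta>2 assms(11,12) by auto
  have ratio: "0 \<le> \<beta>2\<^sup>2 / \<alpha>2\<^sup>2" "\<beta>2\<^sup>2 / \<alpha>2\<^sup>2 < 1"
    using \<beta>2 \<alpha> by (auto simp: abs_square_less_1 simp flip: power_divide)
  have \<Gamma>: "Gamma (m + 1/2) > 0" "Gamma (n + 1/2) > 0" "Gamma (n + 1) > 0"
    using m n by (auto intro!: Gamma_real_pos)
  \<comment> \<open>The moment with the normalizing constant written out; below it is used with
    \<open>a = 1\<close> and \<open>a = m + 1\<close>.\<close>
  have moment: "(LBINT y. \<bar>y\<bar> powr (2 * a - 1) * vg_density n \<alpha>2 \<beta>2 y) =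
      \<gamma>2 powr (2 * n + 1) * 2 powr (2 * a - 1) * Gamma a * Gamma (a + n) /
      (sqrt pi * \<alpha>2 powr (2 * a + 2 * n) * Gamma (n + 1/2)) * hyp2F1 a (a + n) (1/2) (\<beta>2\<^sup>2 / \<alpha>2\<^sup>2)"
    if "a > 0" "a + n > 0" for a
  proof -
    have "2 powr (2 * a + n - 1) = 2 powr (2 * a - 1) * 2 powr n"
      by (simp add: powr_add [symmetric] algebra_simps)
    moreover have "\<alpha>2 powr (2 * a + 2 * n) = \<alpha>2 powr (2 * a + n) * \<alpha>2 powr n"
      by (simp add: powr_add [symmetric] algebra_simps)
    moreover have "(2 * \<alpha>2) powr n = 2 powr n * \<alpha>2 powr n"
      using \<alpha> by (simp add: powr_mult)
    ultimately show ?thesis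
      unfolding vg_density_abs_moment[OF that n \<beta>2] vg_const_def assms(12) [symmetric] powr_minus
      using \<alpha> by (simp add: field_simps)
  qed
  \<comment> \<open>Writing \<open>pi\<close> as \<open>r * r\<close> lets
    \<open>field_simps\<close> cancel the square roots as plain polynomials.\<close>
  define r where "r = sqrt pi"
  have pi_eq: "pi = r * r" and r: "r > 0" by (simp_all add: r_def)
  show "distributed M lborel (\<lambda>\<omega>. X \<omega> / Y \<omega>) (\<lambda>z. ennreal (f_Z z))"
    unfolding assms(13)
    using assms by (intro distributed_ratio_density vg_density_nonneg) (auto simp: vg_distributed_def)
  show "f_Z 0 = \<gamma>1 powr (2 * m + 1) * \<gamma>2 powr (2 * n + 1)
                / (pi * \<alpha>1 powr (2 * m) * \<alpha>2 powr (2 * n + 2))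
              * (Gamma m * Gamma (n + 1) / (Gamma (m + 1/2) * Gamma (n + 1/2)))
              * hyp2F1 1 (n + 1) (1/2) (\<beta>2\<^sup>2 / \<alpha>2\<^sup>2)" if "m > 0"
  proof -
    have p1: "\<alpha>1 powr (2 * m) = \<alpha>1 powr m * \<alpha>1 powr m" by (simp only: mult_2 powr_add)
    have p2: "(2 * \<alpha>1) powr m = 2 powr m * \<alpha>1 powr m" using \<alpha> by (simp add: powr_mult)
    have p3: "2 powr (m - 1) = 2 powr m / 2" by (simp add: powr_diff)
    have fz: "f_Z 0 = vg_const m \<alpha>1 \<beta>1 * \<alpha>1 powr - m * (2 powr (m - 1) * Gamma m) *
        (\<gamma>2 powr (2 * n + 1) * 2 * Gamma (n + 1) / (sqrt pi * \<alpha>2 powr (2 * n + 2) * Gamma (n + 1/2)) *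
          hyp2F1 1 (n + 1) (1/2) (\<beta>2\<^sup>2 / \<alpha>2\<^sup>2))"
      using moment[of 1] that n \<alpha> \<beta>2 by (simp add: assms(13) ratio_density_vg_at_0 add.commute)
    show ?thesis
      unfolding fz p1 p2 p3 vg_const_def assms(11) [symmetric] powr_minus r_def [symmetric] pi_eq
      using \<alpha> r by (simp add: field_simps)
  qed
  show "f_Z \<sim>[at 0] (\<lambda>z. - (2 * \<gamma>1 * \<gamma>2 powr (2 * n + 1)
                / (pi powr (3/2) * \<alpha>2 powr (2 * n + 2)))
              * (Gamma (n + 1) * ln \<bar>z\<bar> / Gamma (n + 1/2))
              * hyp2F1 1 (n + 1) (1/2) (\<beta>2\<^sup>2 / \<alpha>2\<^sup>2))" if "m = 0"
  proof -
    define c where "c = 2 * \<gamma>1 * \<gamma>2 powr (2 * n + 1) / (pi powr (3/2) * \<alpha>2 powr (2 * n + 2))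
        * (Gamma (n + 1) / Gamma (n + 1/2)) * hyp2F1 1 (n + 1) (1/2) (\<beta>2\<^sup>2 / \<alpha>2\<^sup>2)"
    have "hyp2F1 1 (n + 1) (1/2) (\<beta>2\<^sup>2 / \<alpha>2\<^sup>2) > 0"
      using n ratio by (intro hyp2F1_pos) auto
    then have "c \<noteq> 0" using \<gamma> \<alpha> \<Gamma> by (simp add: c_def)
    have "pi powr (3/2) = pi powr (1 + 1/2)" by simp
    also have "\<dots> = pi * sqrt pi" by (subst powr_add) (simp add: powr_half_sqrt)
    finally have pi32: "pi powr (3/2) = pi * sqrt pi" .
    \<comment> \<open>\<open>Gamma (1/2)\<close> is \<open>sqrt pi\<close>, which joins the
      \<open>sqrt pi\<close> of the normalization.\<close>
    have "vg_const 0 \<alpha>1 \<beta>1 = \<gamma>1 / pi"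
      using \<gamma> \<alpha> by (simp add: vg_const_def Gamma_one_half_real flip: assms(11))
    then have "((\<lambda>z. f_Z z / - ln \<bar>z\<bar>) \<longlongrightarrow> \<gamma>1 / pi *
        (\<gamma>2 powr (2 * n + 1) * 2 * Gamma (n + 1) / (sqrt pi * \<alpha>2 powr (2 * n + 2) * Gamma (n + 1/2)) *
          hyp2F1 1 (n + 1) (1/2) (\<beta>2\<^sup>2 / \<alpha>2\<^sup>2))) (at 0)"
      using ratio_density_vg_zero[OF n \<beta>1 \<beta>2] moment[of 1] n by (simp add: assms(13) that add.commute mult_ac)
    also have "\<gamma>1 / pi *
        (\<gamma>2 powr (2 * n + 1) * 2 * Gamma (n + 1) / (sqrt pi * \<alpha>2 powr (2 * n + 2) * Gamma (n + 1/2)) *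
          hyp2F1 1 (n + 1) (1/2) (\<beta>2\<^sup>2 / \<alpha>2\<^sup>2)) = c"
      unfolding c_def pi32 by (simp add: mult_ac)
    finally have "f_Z \<sim>[at 0] (\<lambda>z. c * - ln \<bar>z\<bar>)"
      using \<open>c \<noteq> 0\<close> by (rule asymp_equivI'_const)
    then show ?thesis by (simp add: c_def mult_ac)
  qed
  show "f_Z \<sim>[at 0] (\<lambda>z. \<gamma>1 powr (2 * m + 1) * \<gamma>2 powr (2 * n + 1)
                / (\<alpha>2 powr (2 * m + 2 * n + 2) * sin (- m * pi))
              * (Gamma (m + n + 1) * \<bar>z\<bar> powr (2 * m) / (Gamma (m + 1/2) * Gamma (n + 1/2)))
              * hyp2F1 (m + 1) (m + n + 1) (1/2) (\<beta>2\<^sup>2 / \<alpha>2\<^sup>2))" if "m < 0"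
  proof -
    let ?F = "hyp2F1 (m + 1) (m + n + 1) (1/2) (\<beta>2\<^sup>2 / \<alpha>2\<^sup>2)"
    define c where "c = \<gamma>1 powr (2 * m + 1) * \<gamma>2 powr (2 * n + 1) / (\<alpha>2 powr (2 * m + 2 * n + 2) * sin (- m * pi))
        * (Gamma (m + n + 1) / (Gamma (m + 1/2) * Gamma (n + 1/2))) * ?F"
    have F: "?F > 0" using m n ratio by (intro hyp2F1_pos) auto
    have G: "Gamma (m + n + 1) > 0" using m n by (intro Gamma_real_pos) auto
    \<comment> \<open>From \<open>0 < - m < 1\<close> the sine is positive, which is needed for
      \<open>c \<noteq> 0\<close>.\<close>
    have "pi * - m < pi * 1" using m pi_gt_zero by (intro mult_strict_left_mono) auto
    then have "sin (pi * - m) > 0" using that by (intro sin_gt_zero mult_pos_pos) auto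
    then have s: "sin (- m * pi) > 0" by (simp add: mult.commute)
    have "c \<noteq> 0" using \<gamma> \<alpha> \<Gamma> F G s by (simp add: c_def)
    \<comment> \<open>\<open>Gamma (- m)\<close> stems from the singularity of the first density,
      \<open>Gamma (m + 1)\<close> from the moment of the second; their product yields the sine and
      cancels \<open>pi\<close>.\<close>
    have refl: "Gamma (- m) * Gamma (m + 1) = pi / sin (- m * pi)"
      using Gamma_reflection_real[of "- m"] by (simp add: add.commute mult.commute)
    have "((\<lambda>z. f_Z z / \<bar>z\<bar> powr (2 * m)) \<longlongrightarrow>
        vg_const m \<alpha>1 \<beta>1 * \<alpha>1 powr m * (2 powr (- m - 1) * Gamma (- m)) *
        (\<gamma>2 powr (2 * n + 1) * 2 powr (2 * m + 1) * Gamma (m + 1) * Gamma (m + n + 1) /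
          (sqrt pi * \<alpha>2 powr (2 * m + 2 * n + 2) * Gamma (n + 1/2)) * ?F)) (at 0)"
      using ratio_density_vg_neg[OF m that n \<beta>1 \<beta>2] moment[of "m + 1"] m n
      by (simp add: assms(13) algebra_simps)
    also have "vg_const m \<alpha>1 \<beta>1 * \<alpha>1 powr m * (2 powr (- m - 1) * Gamma (- m)) *
        (\<gamma>2 powr (2 * n + 1) * 2 powr (2 * m + 1) * Gamma (m + 1) * Gamma (m + n + 1) /
          (sqrt pi * \<alpha>2 powr (2 * m + 2 * n + 2) * Gamma (n + 1/2)) * ?F) =
        \<gamma>1 powr (2 * m + 1) * \<gamma>2 powr (2 * n + 1) / (pi * \<alpha>2 powr (2 * m + 2 * n + 2))
        * (Gamma (m + n + 1) * (Gamma (- m) * Gamma (m + 1)) / (Gamma (m + 1/2) * Gamma (n + 1/2))) * ?F"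
    proof -
      have p1: "(2 * \<alpha>1) powr m = 2 powr m * \<alpha>1 powr m" using \<alpha> by (simp add: powr_mult)
      have p2: "2 powr (2 * m + 1) = 2 * (2 powr m * 2 powr m)"
        by (simp only: mult_2 powr_add) simp
      have p3: "2 powr (- m - 1) = 1 / (2 * 2 powr m)"
        by (simp add: powr_diff powr_minus field_simps)
      show ?thesis
        unfolding p1 p2 p3 vg_const_def assms(11) [symmetric] r_def [symmetric] pi_eq
        using \<alpha> r by (simp add: field_simps)
    qed
    also have "\<dots> = c" unfolding refl c_def by simp
    finally have "f_Z \<sim>[at 0] (\<lambda>z. c * \<bar>z\<bar> powr (2 * m))"
      using \<open>c \<noteq> 0\<close> by (rule asymp_equivI'_const)
    then show ?thesis by (simp add: c_def mult_ac)
  qed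
qed

end
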